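(* Let $a,b,c,\mu\in\mathbb{C}$. In each identity below assume that the arguments of the three gamma functions in the numerator on the right-hand side have positive real parts, and that the lower (third) parameters of the hypergeometric functions in the two $w_j$'s occurring are not in $\mathbb{Z}_{\le0}$. (1) For $x\in(0,1)\cup(1,\infty)$: $$\int_{-\infty}^0(1-y)^{a+b-c}w_2(y;a,b,c)(x-y)^{\mu-1}dy=\frac{\Gamma(c-a-\mu)\Gamma(c-b-\mu)\Gamma(2-c)}{\Gamma(c-a-b-\mu+1)\Gamma(1-\mu)}\,|1-x|^{a+b-c+\mu}w_6(x;a,b,c-\mu).$$ (2) For $x\in(-\infty,0)\cup(0,1)$: $$\int_1^\infty(y-1)^{a+b-c}w_5(y;a,b,c)(y-x)^{\mu-1}dy=\frac{\Gamma(c-a-\mu)\Gamma(c-b-\mu)\Gamma(a+b-c+1)}{\Gamma(c-\mu)\Gamma(1-\mu)}\,(1-x)^{a+b-c+\mu}w_1(x;a,b,c-\mu).$$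
   Context: Write $F(a,b;c;z)={}_2F_1(a,b;c;z)$ for the Gauss hypergeometric function (power series for $|z|<1$, analytically continued to $\mathbb{C}\setminus[1,\infty)$, with $c\notin\mathbb{Z}_{\le0}$). Define $w_1(x;a,b,c)=F(a,b;c;x)$ for $x\in(-\infty,1)$; $w_2(x;a,b,c)=|x|^{1-c}F(a-c+1,b-c+1;2-c;x)$ for $x\in(-\infty,0)\cup(0,1)$; $w_5(x;a,b,c)=F(a,b;a+b-c+1;1-x)$ for $x\in(0,\infty)$; $w_6(x;a,b,c)=|1-x|^{c-a-b}F(c-a,c-b;c-a-b+1;1-x)$ for $x\in(0,1)\cup(1,\infty)$. Convention: $1/\Gamma$ is entire, with value $0$ at nonpositive integers. *)

theory Defs
  imports "HOL-Complex_Analysis.Complex_Analysis"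
begin

definition hyp_slit_plane :: "complex set" where
  "hyp_slit_plane = - (complex_of_real ` {1..})"

text \<open>The choice only matters on the cut: the slit plane is connected, so two candidates agree
  on it by the identity theorem.\<close>

definition hyp2F1 :: "complex \<Rightarrow> complex \<Rightarrow> complex \<Rightarrow> complex \<Rightarrow> complex" where
  "hyp2F1 a b c =
     (SOME f. f holomorphic_on hyp_slit_plane \<and>
              (\<forall>z\<in>ball 0 1. f z = eval_fps (fps_hypergeo [a, b] [c] 1) z))"

lemma eval_fps_hypergeo_2F1:
  "eval_fps (fps_hypergeo [a, b] [c] 1) z =
     (\<Sum>n. pochhammer a n * pochhammer b n / (pochhammer c n * fact n) * (z :: complex) ^ n)"
  by (simp add: eval_fps_def fps_hypergeo_def)

definition w1 :: "real \<Rightarrow> complex \<Rightarrow> complex \<Rightarrow> complex \<Rightarrow> complex" where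
  "w1 x a b c = hyp2F1 a b c (complex_of_real x)"

definition w2 :: "real \<Rightarrow> complex \<Rightarrow> complex \<Rightarrow> complex \<Rightarrow> complex" where
  "w2 x a b c = complex_of_real \<bar>x\<bar> powr (1 - c) *
     hyp2F1 (a - c + 1) (b - c + 1) (2 - c) (complex_of_real x)"

definition w5 :: "real \<Rightarrow> complex \<Rightarrow> complex \<Rightarrow> complex \<Rightarrow> complex" where
  "w5 x a b c = hyp2F1 a b (a + b - c + 1) (complex_of_real (1 - x))"

definition w6 :: "real \<Rightarrow> complex \<Rightarrow> complex \<Rightarrow> complex \<Rightarrow> complex" where
  "w6 x a b c = complex_of_real \<bar>1 - x\<bar> powr (c - a - b) *
     hyp2F1 (c - a) (c - b) (c - a - b + 1) (complex_of_real (1 - x))"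

end

theory Submission
  imports Defs "HOL-Real_Asymp.Real_Asymp"
begin

text \<open>
  Both identities are instances of one formula (the first after Euler's transformation of the
  integrand, the second after Euler's transformation of the value): for \<open>s > 0\<close>,
  \<open>\<integral>\<^sub>0\<^sup>\<infinity> t\<^bsup>C-1\<^esup> F(A,B;C;-t) (t+s)\<^bsup>-\<nu>\<^esup> dt\<close> equals
  \<open>\<Gamma>(C)\<Gamma>(\<alpha>)\<Gamma>(\<beta>) / (\<Gamma>(\<nu>)\<Gamma>(\<delta>)) F(\<alpha>,\<beta>;\<delta>;1-s)\<close> with \<open>\<alpha> = A-C+\<nu>\<close>, \<open>\<beta> = B-C+\<nu>\<close>,
  \<open>\<delta> = A+B-C+\<nu>\<close>. Pfaff's transformation and \<open>t = u/(1-u)\<close> turn the left-hand side into an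
  integral over \<open>(0,1)\<close> of \<open>u\<^bsup>C-1\<^esup> (1-u)\<^bsup>\<alpha>-1\<^esup> F(A,C-B;C;u) (1-w(1-u))\<^bsup>-\<nu>\<^esup>\<close> with \<open>w = 1-s\<close>,
  which is holomorphic in \<open>w\<close> on the slit plane. Expanding in powers of \<open>w\<close>, each coefficient is
  a series of Beta integrals summed by Gauss' theorem.

  The same transform provides the analytic continuation of \<open>F(\<alpha>,\<beta>;\<delta>;w)\<close> to the slit plane when
  \<open>Re \<alpha>\<close> and \<open>Re \<beta>\<close> are positive; since differentiation raises all three parameters by one and
  the slit plane is starlike, repeated primitives give it for all \<open>\<alpha>\<close>, \<open>\<beta>\<close>.
\<close>

subsection \<open>Gauss summation\<close>

lemma ex_Re_add_nat_pos: "\<exists>k::nat. Re z + real k > 0"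
proof -
  obtain k :: nat where "- Re z < real k"
    using reals_Archimedean2 by blast
  then have "Re z + real k > 0"
    by simp
  then show ?thesis ..
qed

text \<open>Reciprocal of the limit formula for the gamma function. In this form poles are harmless:
  at a nonpositive integer the Pochhammer symbol is eventually 0, which matches
  \<open>rGamma z = 0\<close>.\<close>

lemma pochhammer_over_asymp_LIMSEQ:
  fixes z :: complex
  shows "(\<lambda>n. pochhammer z n / (fact (n - 1) * exp (z * of_real (ln (of_nat n))))) \<longlonglongrightarrow> rGamma z"
proof (cases "z \<in> \<int>\<^sub>\<le>\<^sub>0")
  case False
  then have "(\<lambda>n. inverse (Gamma_series' z n)) \<longlonglongrightarrow> inverse (Gamma z)"
    by (intro tendsto_inverse Gamma_series'_LIMSEQ) (auto simp: Gamma_eq_zero_iff)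
  then show ?thesis
    by (simp add: Gamma_series'_def rGamma_inverse_Gamma)
next
  case True
  then obtain k where k: "z = - of_nat k"
    by (auto elim: nonpos_Ints_cases')
  have "eventually (\<lambda>n. pochhammer z n / (fact (n - 1) * exp (z * of_real (ln (of_nat n)))) = 0) sequentially"
    using eventually_gt_at_top[of k]
    by eventually_elim (auto simp: k pochhammer_of_nat_eq_0_iff)
  moreover have "rGamma z = 0"
    using True by (simp add: rGamma_eq_zero_iff)
  ultimately show ?thesis
    by (simp only: tendsto_eventually)
qed

lemma norm_pochhammer_asymp:
  assumes "n > 0"
  shows "norm (fact (n - 1) * exp (z * of_real (ln (of_nat n))) :: complex) = fact (n - 1) * real n powr Re z"
  using assms by (simp add: norm_mult powr_def)

lemma norm_pochhammer_bigo:
  fixes z :: complex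
  shows "(\<lambda>n. norm (pochhammer z n)) \<in> O(\<lambda>n. fact (n - 1) * real n powr Re z)"
proof -
  have "(\<lambda>n. norm (pochhammer z n / (fact (n - 1) * exp (z * of_real (ln (of_nat n)))))) \<longlonglongrightarrow> norm (rGamma z)"
    by (intro tendsto_norm pochhammer_over_asymp_LIMSEQ)
  moreover have "eventually (\<lambda>n. norm (pochhammer z n / (fact (n - 1) * exp (z * of_real (ln (of_nat n))))) =
     norm (pochhammer z n) / (fact (n - 1) * real n powr Re z)) sequentially"
    using eventually_gt_at_top[of 0]
    by eventually_elim (simp only: norm_divide norm_pochhammer_asymp)
  ultimately have "(\<lambda>n. norm (pochhammer z n) / (fact (n - 1) * real n powr Re z)) \<longlonglongrightarrow> norm (rGamma z)"
    by (rule Lim_transform_eventually)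
  then show ?thesis
    by (rule bigoI_tendsto) (auto intro: eventually_mono[OF eventually_gt_at_top[of 0]])
qed

lemma inverse_norm_pochhammer_bigo:
  fixes z :: complex
  assumes "z \<notin> \<int>\<^sub>\<le>\<^sub>0"
  shows "(\<lambda>n. inverse (norm (pochhammer z n))) \<in> O(\<lambda>n. inverse (fact (n - 1) * real n powr Re z))"
proof -
  have "(\<lambda>n. norm (Gamma_series' z n)) \<longlonglongrightarrow> norm (Gamma z)"
    by (intro tendsto_norm Gamma_series'_LIMSEQ)
  moreover have "eventually (\<lambda>n. norm (Gamma_series' z n) =
     inverse (norm (pochhammer z n)) / inverse (fact (n - 1) * real n powr Re z)) sequentially"
    using eventually_gt_at_top[of 0]
    by eventually_elim (simp only: Gamma_series'_def norm_divide norm_pochhammer_asymp, simp add: divide_simps)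
  ultimately have "(\<lambda>n. inverse (norm (pochhammer z n)) / inverse (fact (n - 1) * real n powr Re z)) \<longlonglongrightarrow> norm (Gamma z)"
    by (rule Lim_transform_eventually)
  then show ?thesis
    by (rule bigoI_tendsto) (auto intro: eventually_mono[OF eventually_gt_at_top[of 0]])
qed

text \<open>For Re c > 0 the value is \<open>rGamma c\<close> over a Pochhammer symbol. Other c are
  reached by induction on a shift k with Re c + k > 0: the functional equation trades c for c + 1 at
  the price of a factor c + m, which is O(m) and lowers the exponent of m by one.\<close>

lemma norm_rGamma_shift_bigo:
  fixes c :: complex
  shows "(\<lambda>m. norm (rGamma (c + of_nat m))) \<in> O(\<lambda>m. inverse (fact (m - 1) * real m powr Re c))"
proof -
  have "(\<lambda>m. norm (rGamma (c + of_nat m))) \<in> O(\<lambda>m. inverse (fact (m - 1) * real m powr Re c))"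
    if "Re c + real k > 0" for k c
    using that
  proof (induction k arbitrary: c)
    case 0
    then have c: "c \<notin> \<int>\<^sub>\<le>\<^sub>0"
      by (auto elim!: nonpos_Ints_cases)
    have "rGamma (c + of_nat m) = rGamma c * inverse (pochhammer c m)" for m
      using pochhammer_rGamma[of c m] pochhammer_eq_0_imp_nonpos_Int[of c m] c
      by (auto simp: field_simps simp del: pochhammer_eq_0_iff)
    then show ?case
      using inverse_norm_pochhammer_bigo[OF c] by (simp add: norm_mult norm_inverse)
  next
    case (Suc k)
    have IH: "(\<lambda>m. norm (rGamma (c + 1 + of_nat m))) \<in> O(\<lambda>m. inverse (fact (m - 1) * real m powr Re (c + 1)))"
      by (rule Suc.IH) (use Suc.prems in simp)
    have "(\<lambda>m. norm (c + of_nat m)) \<in> O(\<lambda>m. real m)"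
    proof (rule bigoI)
      show "eventually (\<lambda>m. norm (norm (c + of_nat m)) \<le> (norm c + 1) * norm (real m)) at_top"
        using eventually_gt_at_top[of 0]
      proof eventually_elim
        case (elim m)
        have "norm (c + of_nat m) \<le> norm c + real m"
          by (metis norm_triangle_ineq norm_of_nat)
        also have "\<dots> \<le> norm c * real m + real m"
          using elim by (simp add: mult_le_cancel_left1)
        finally show ?case by (simp add: algebra_simps)
      qed
    qed
    from landau_o.big.mult[OF this IH]
    have "(\<lambda>m. norm (c + of_nat m) * norm (rGamma (c + 1 + of_nat m))) \<in>
      O(\<lambda>m. real m * inverse (fact (m - 1) * real m powr Re (c + 1)))" .
    also have "(\<lambda>m. norm (c + of_nat m) * norm (rGamma (c + 1 + of_nat m))) = (\<lambda>m. norm (rGamma (c + of_nat m)))"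
    proof
      fix m
      have "rGamma (c + of_nat m) = (c + of_nat m) * rGamma (c + 1 + of_nat m)"
        using rGamma_plus1[of "c + of_nat m"] by (simp add: add_ac)
      then show "norm (c + of_nat m) * norm (rGamma (c + 1 + of_nat m)) = norm (rGamma (c + of_nat m))"
        by (simp add: norm_mult)
    qed
    also have "O(\<lambda>m. real m * inverse (fact (m - 1) * real m powr Re (c + 1))) = O(\<lambda>m. inverse (fact (m - 1) * real m powr Re c))"
      by (rule landau_o.big.cong, rule eventually_mono[OF eventually_gt_at_top[of 0]])
         (simp add: powr_add field_simps)
    finally show ?case .
  qed
  moreover obtain k :: nat where "Re c + real k > 0"
    using ex_Re_add_nat_pos by blast
  ultimately show ?thesis by blast
qed

text \<open>Regularised with \<open>1/\<Gamma>(c+m)\<close> instead of \<open>1/(c)\<^sub>m\<close>, so that no value of \<open>c\<close> is excluded.\<close>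

definition gauss_term :: "complex \<Rightarrow> complex \<Rightarrow> complex \<Rightarrow> nat \<Rightarrow> complex" where
  "gauss_term a b c m = pochhammer a m * pochhammer b m / fact m * rGamma (c + of_nat m)"

text \<open>The factorials contribute (m-1)!/m! = 1/m, which is the -1 in the exponent.\<close>

lemma norm_gauss_term_bigo:
  "(\<lambda>m. norm (gauss_term a b c m)) \<in> O(\<lambda>m. real m powr (Re (a + b - c) - 1))"
proof -
  have "(\<lambda>m. norm (pochhammer a m) * norm (pochhammer b m) * norm (rGamma (c + of_nat m)) * inverse (fact m)) \<in>
    O(\<lambda>m. (fact (m - 1) * real m powr Re a) * (fact (m - 1) * real m powr Re b) *
      (inverse (fact (m - 1) * real m powr Re c)) * inverse (fact m))"
    by (intro landau_o.big.mult norm_pochhammer_bigo norm_rGamma_shift_bigo landau_o.big_refl)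
  also have "(\<lambda>m. norm (pochhammer a m) * norm (pochhammer b m) * norm (rGamma (c + of_nat m)) * inverse (fact m)) =
      (\<lambda>m. norm (gauss_term a b c m))"
    by (simp add: fun_eq_iff gauss_term_def norm_mult norm_divide field_simps)
  also have "O(\<lambda>m. (fact (m - 1) * real m powr Re a) * (fact (m - 1) * real m powr Re b) *
      (inverse (fact (m - 1) * real m powr Re c)) * inverse (fact m)) = O(\<lambda>m. real m powr (Re (a + b - c) - 1))"
    by (rule landau_o.big.cong, rule eventually_mono[OF eventually_gt_at_top[of 0]])
       (simp add: powr_add powr_diff field_simps fact_reduce)
  finally show ?thesis .
qed

section \<open>The contiguous relation in the lower parameter and Gauss' theorem\<close>

lemma summable_norm_gauss_term:
  assumes "Re (c - a - b) > 0"
  shows "summable (\<lambda>m. norm (gauss_term a b c m))"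
proof (rule summable_comparison_test_bigo)
  show "summable (\<lambda>m. norm (real m powr (Re (a + b - c) - 1)))"
    using assms by (simp add: summable_real_powr_iff)
  show "(\<lambda>m. norm (gauss_term a b c m)) \<in> O(\<lambda>m. real m powr (Re (a + b - c) - 1))"
    by (rule norm_gauss_term_bigo)
qed

text \<open>The relation telescopes: termwise the difference of the two sides is G(m) - G(m+1) with
  G(m) = m times the m-th term. Both ends vanish, G(0) trivially and the limit because G(m) is
  O(m^Re(a+b-c)).\<close>

lemma gauss_sum_contiguous:
  assumes "Re (c - a - b) > 0"
  shows "(c - a - b) * (\<Sum>m. gauss_term a b c m) = (c - a) * (c - b) * (\<Sum>m. gauss_term a b (c + 1) m)"
proof -
  define G where "G m = of_nat m * gauss_term a b c m" for m
  have s: "summable (gauss_term a b c)" "summable (gauss_term a b (c + 1))"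
    using assms by (auto intro!: summable_norm_cancel[OF summable_norm_gauss_term])
  have eq: "(c - a - b) * gauss_term a b c m - (c - a) * (c - b) * gauss_term a b (c + 1) m = G m - G (Suc m)" for m
  proof -
    have "rGamma (c + of_nat m) = (c + of_nat m) * rGamma (c + 1 + of_nat m)"
      using rGamma_plus1[of "c + of_nat m"] by (simp add: add_ac)
    then show ?thesis
      unfolding G_def gauss_term_def
      by (simp add: pochhammer_Suc divide_simps add_ac del: of_nat_Suc) (simp add: algebra_simps)
  qed
  have "(\<lambda>m. norm (G m)) \<longlonglongrightarrow> 0"
  proof -
    have "(\<lambda>m. real m * norm (gauss_term a b c m)) \<in> O(\<lambda>m. real m * real m powr (Re (a + b - c) - 1))"
      by (intro landau_o.big.mult landau_o.big_refl norm_gauss_term_bigo)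
    also have "(\<lambda>m. real m * real m powr (Re (a + b - c) - 1)) \<in> o(\<lambda>_. 1)"
      using assms by (intro smalloI_tendsto) (simp, real_asymp, simp)
    finally show ?thesis
      by (auto dest!: smalloD_tendsto simp: G_def norm_mult)
  qed
  then have "G \<longlonglongrightarrow> 0"
    by (simp add: tendsto_norm_zero_iff)
  then have "(\<lambda>m. G m - G (Suc m)) sums (G 0 - 0)"
    by (rule telescope_sums')
  moreover have "(\<lambda>m. (c - a - b) * gauss_term a b c m - (c - a) * (c - b) * gauss_term a b (c + 1) m) sums
     ((c - a - b) * (\<Sum>m. gauss_term a b c m) - (c - a) * (c - b) * (\<Sum>m. gauss_term a b (c + 1) m))"
    using s by (intro sums_diff sums_mult summable_sums)
  ultimately show ?thesis
    unfolding eq by (simp add: G_def sums_iff)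
qed


text \<open>Holds factor by factor. Since x may be smaller than Re z, the one bound with x = Re c
  serves all shifts z = c + n at once.\<close>

lemma pochhammer_Re_le_norm:
  assumes "0 < x" "x \<le> Re z"
  shows "pochhammer x k \<le> norm (pochhammer z k)"
  unfolding pochhammer_prod prod_norm[symmetric]
proof (rule prod_mono)
  fix i
  have "x + real i \<le> Re (z + of_nat i)"
    using assms by simp
  also have "\<dots> \<le> norm (z + of_nat i)"
    by (rule complex_Re_le_cmod)
  finally show "0 \<le> x + of_nat i \<and> x + of_nat i \<le> norm (z + of_nat i)"
    using assms by simp
qed

lemma gauss_sum_iterate:
  assumes "Re (c - a - b) > 0"
  shows "pochhammer (c - a - b) N * (\<Sum>m. gauss_term a b c m) =
    pochhammer (c - a) N * pochhammer (c - b) N * (\<Sum>m. gauss_term a b (c + of_nat N) m)"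
proof (induction N)
  case (Suc N)
  have "pochhammer (c - a - b) (Suc N) * (\<Sum>m. gauss_term a b c m) =
     (c - a - b + of_nat N) * (pochhammer (c - a - b) N * (\<Sum>m. gauss_term a b c m))"
    by (simp add: pochhammer_Suc)
  also have "\<dots> = pochhammer (c - a) N * pochhammer (c - b) N *
      (((c + of_nat N) - a - b) * (\<Sum>m. gauss_term a b (c + of_nat N) m))"
    unfolding Suc.IH by (simp add: algebra_simps)
  also have "\<dots> = pochhammer (c - a) N * pochhammer (c - b) N *
      (((c + of_nat N) - a) * ((c + of_nat N) - b) * (\<Sum>m. gauss_term a b (c + of_nat (Suc N)) m))"
    using assms gauss_sum_contiguous[of "c + of_nat N" a b] by (simp add: add_ac)
  finally show ?case
    by (simp add: pochhammer_Suc algebra_simps)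
qed auto

text \<open>After multiplication by the gamma factor the m-th term is (a)_m (b)_m / (m! (c+N)_m),
  which is 1 for m = 0 and tends to 0 for m > 0. Tannery's theorem allows the limit to be taken
  inside the sum.\<close>

lemma gauss_sum_shift_asymp:
  assumes c: "Re c > 0" and abc: "Re (c - a - b) > 0"
  shows "(\<lambda>N. (\<Sum>m. gauss_term a b (c + of_nat N) m) * Gamma (c + of_nat N)) \<longlonglongrightarrow> 1"
proof -
  define t where "t k n = pochhammer a k * pochhammer b k / (fact k * pochhammer (c + of_nat n) k)" for k n :: nat
  \<comment> \<open>The majorant is the modulus of the term with c + N replaced by the real number
    Re c. Writing it through \<open>gauss_term\<close> gives its summability for free, as Re (c - a
    - b) is unchanged.\<close>
  define M where "M k = norm (gauss_term a b (of_real (Re c)) k) * norm (Gamma (of_real (Re c)) :: complex)" for k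
  have npos: "c + of_nat n \<notin> \<int>\<^sub>\<le>\<^sub>0" for n
    using c by (auto elim!: nonpos_Ints_cases simp: complex_eq_iff)
  have M_eq: "M k = norm (pochhammer a k * pochhammer b k) / (fact k * pochhammer (Re c) k)" for k
  proof -
    let ?r = "of_real (Re c) :: complex"
    have 1: "norm (pochhammer ?r k) = pochhammer (Re c) k"
      using pochhammer_pos[OF c, of k] by (simp add: pochhammer_of_real)
    have "?r \<notin> \<int>\<^sub>\<le>\<^sub>0"
      using c by (auto elim!: nonpos_Ints_cases simp: complex_eq_iff)
    then have "rGamma ?r * Gamma ?r = 1"
      by (simp add: rGamma_inverse_Gamma Gamma_eq_zero_iff)
    then have "norm (pochhammer ?r k) * (norm (rGamma (?r + of_nat k)) * norm (Gamma ?r)) = 1"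
      unfolding norm_mult[symmetric] by (subst (asm) pochhammer_rGamma[of _ k]) (simp only: mult.assoc norm_one)
    then have "norm (rGamma (?r + of_nat k)) * norm (Gamma ?r) = 1 / pochhammer (Re c) k"
      unfolding 1 using pochhammer_pos[OF c, of k] by (simp add: field_simps)
    then show ?thesis
      using pochhammer_pos[OF c, of k] by (simp add: M_def gauss_term_def norm_mult norm_divide divide_simps mult_ac)
  qed
  have bound: "norm (t k n) \<le> M k" for k n
  proof -
    have "pochhammer (Re c) k \<le> norm (pochhammer (c + of_nat n) k)"
      using c by (intro pochhammer_Re_le_norm) auto
    then show ?thesis
      unfolding M_eq t_def norm_mult norm_divide
      using pochhammer_pos[OF c, of k] by (intro divide_left_mono mult_mono mult_pos_pos) auto
  qed
  have "(\<lambda>n. suminf (\<lambda>k. t k n)) \<longlonglongrightarrow> suminf (\<lambda>k. if k = 0 then 1 else 0)"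
  proof (rule tannerys_theorem[THEN conjunct2, THEN conjunct2])
    show "summable M"
      unfolding M_def using abc by (intro summable_mult2 summable_norm_gauss_term) auto
    show "\<forall>\<^sub>F (k, n) in at_top \<times>\<^sub>F sequentially. norm (t k n) \<le> M k"
      using bound by (auto intro: always_eventually)
    show "(\<lambda>n. t k n) \<longlonglongrightarrow> (if k = 0 then 1 else 0)" for k
    proof (cases k)
      case 0
      then show ?thesis by (simp add: t_def)
    next
      case (Suc j)
      have "(\<lambda>n. t k n) \<longlonglongrightarrow> 0"
      proof (rule Lim_null_comparison)
        \<comment> \<open>With k = j + 1, the first factor c + n of the Pochhammer symbol supplies
          the decay in n; the remaining j factors are bounded below by (Re c)_j, uniformly in
          n.\<close>
        define K where "K = norm (pochhammer a k * pochhammer b k) / (fact k * pochhammer (Re c) j)"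
        show "(\<lambda>n. K / (Re c + real n)) \<longlonglongrightarrow> 0"
          by real_asymp
        show "\<forall>\<^sub>F n in sequentially. norm (t k n) \<le> K / (Re c + real n)"
        proof (intro always_eventually allI)
          fix n
          have "(Re c + real n) * pochhammer (Re c) j \<le> norm (c + of_nat n) * norm (pochhammer (c + of_nat n + 1) j)"
            using c complex_Re_le_cmod[of "c + of_nat n"] pochhammer_pos[OF c, of j]
            by (intro mult_mono pochhammer_Re_le_norm) auto
          also have "\<dots> = norm (pochhammer (c + of_nat n) k)"
            by (simp add: Suc pochhammer_rec norm_mult)
          finally have le: "(Re c + real n) * pochhammer (Re c) j \<le> norm (pochhammer (c + of_nat n) k)" .
          have pos: "0 < (Re c + real n) * pochhammer (Re c) j"
            using pochhammer_pos[OF c, of j] c by (intro mult_pos_pos) auto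
          then have nz: "0 < norm (pochhammer (c + of_nat n) k)"
            using le by linarith
          have "norm (t k n) \<le> norm (pochhammer a k * pochhammer b k) / (fact k * ((Re c + real n) * pochhammer (Re c) j))"
            unfolding t_def norm_mult norm_divide
            using le nz pochhammer_pos[OF c, of j] c by (intro divide_left_mono mult_mono mult_pos_pos) auto
          then show "norm (t k n) \<le> K / (Re c + real n)"
            by (simp add: K_def field_simps)
        qed
      qed
      with Suc show ?thesis by simp
    qed
  qed simp
  also have "suminf (\<lambda>k. if k = 0 then 1 else 0 :: complex) = 1"
    using sums_If_finite_set[of "{0}" "\<lambda>_. 1 :: complex"] by (simp add: sums_iff)
  also have "(\<lambda>n. suminf (\<lambda>k. t k n)) = (\<lambda>N. (\<Sum>m. gauss_term a b (c + of_nat N) m) * Gamma (c + of_nat N))"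
  proof
    fix N
    have "t m N = gauss_term a b (c + of_nat N) m * Gamma (c + of_nat N)" for m
    proof -
      have "pochhammer (c + of_nat N) m \<noteq> 0"
        using npos[of N] pochhammer_eq_0_imp_nonpos_Int by blast
      then have "rGamma (c + of_nat N + of_nat m) = rGamma (c + of_nat N) / pochhammer (c + of_nat N) m"
        by (subst pochhammer_rGamma[of "c + of_nat N" m]) simp
      moreover have "rGamma (c + of_nat N) * Gamma (c + of_nat N) = 1"
        using npos[of N] by (simp add: rGamma_inverse_Gamma Gamma_eq_zero_iff)
      ultimately show ?thesis
        by (simp add: t_def gauss_term_def field_simps)
    qed
    moreover have "summable (gauss_term a b (c + of_nat N))"
      using abc by (intro summable_norm_cancel[OF summable_norm_gauss_term]) auto
    ultimately show "(\<Sum>k. t k N) = (\<Sum>m. gauss_term a b (c + of_nat N) m) * Gamma (c + of_nat N)"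
      by (simp add: suminf_mult2)
  qed
  finally show ?thesis .
qed

text \<open>Let N tend to infinity in the N-fold contiguous relation: the shifted series, normalised
  by its gamma factor, tends to 1, and the quotient of Pochhammer symbols tends to a quotient of
  reciprocal gamma values. This needs Re c > 0 and is done first; a finite shift then covers the
  other c.\<close>

theorem gauss_summation:
  assumes "Re (c - a - b) > 0"
  shows "(\<Sum>m. gauss_term a b c m) = Gamma (c - a - b) * rGamma (c - a) * rGamma (c - b)"
proof -
  have pos: "(\<Sum>m. gauss_term a b c m) = Gamma (c - a - b) * rGamma (c - a) * rGamma (c - b)"
    if c: "Re c > 0" and abc: "Re (c - a - b) > 0" for c
  proof -
    define X where "X z n = fact (n - 1) * exp (z * of_real (ln (of_nat n)))" for z :: complex and n :: nat
    define P where "P z n = pochhammer z n / X z n" for z :: complex and n :: nat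
    have P: "P z \<longlonglongrightarrow> rGamma z" for z
      unfolding P_def X_def by (rule pochhammer_over_asymp_LIMSEQ)
    have X0: "X z n \<noteq> 0" for z n
      by (simp add: X_def)
    have npos: "c \<notin> \<int>\<^sub>\<le>\<^sub>0" "c - a - b \<notin> \<int>\<^sub>\<le>\<^sub>0"
      using c abc by (auto elim!: nonpos_Ints_cases simp: complex_eq_iff)
    have nz: "pochhammer c n \<noteq> 0" "pochhammer (c - a - b) n \<noteq> 0" for n
      using npos pochhammer_eq_0_imp_nonpos_Int by blast+
    have "(\<lambda>N. P (c - a) N * P (c - b) N / (P (c - a - b) N * P c N) * rGamma c *
        ((\<Sum>m. gauss_term a b (c + of_nat N) m) * Gamma (c + of_nat N))) \<longlonglongrightarrow>
       rGamma (c - a) * rGamma (c - b) / (rGamma (c - a - b) * rGamma c) * rGamma c * 1"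
      using npos
      by (intro tendsto_intros P gauss_sum_shift_asymp c abc) (auto simp: rGamma_eq_zero_iff)
    also have "(\<lambda>N. P (c - a) N * P (c - b) N / (P (c - a - b) N * P c N) * rGamma c *
        ((\<Sum>m. gauss_term a b (c + of_nat N) m) * Gamma (c + of_nat N))) = (\<lambda>N. \<Sum>m. gauss_term a b c m)"
    proof
      fix N
      \<comment> \<open>The normalising factors cancel because (c-a) + (c-b) = (c-a-b) + c.\<close>
      have XX: "X (c - a) N * X (c - b) N = X (c - a - b) N * X c N"
      proof -
        let ?l = "of_real (ln (of_nat N)) :: complex"
        have "exp ((c - a) * ?l) * exp ((c - b) * ?l) = exp ((c - a - b) * ?l) * exp (c * ?l)"
          unfolding exp_add[symmetric] by (rule arg_cong[where f = exp]) (simp add: algebra_simps)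
        then show ?thesis
          by (simp add: X_def mult_ac)
      qed
      have "P (c - a) N * P (c - b) N / (P (c - a - b) N * P c N) =
          pochhammer (c - a) N * pochhammer (c - b) N / (pochhammer (c - a - b) N * pochhammer c N) *
          (X (c - a - b) N * X c N / (X (c - a) N * X (c - b) N))"
        by (simp add: P_def)
      also have "\<dots> = pochhammer (c - a) N * pochhammer (c - b) N / (pochhammer (c - a - b) N * pochhammer c N)"
        unfolding XX using X0 by simp
      finally have 1: "P (c - a) N * P (c - b) N / (P (c - a - b) N * P c N) = \<dots>" .
      have "c + of_nat N \<notin> \<int>\<^sub>\<le>\<^sub>0"
        using c by (auto elim!: nonpos_Ints_cases simp: complex_eq_iff)
      then have 2: "rGamma c * Gamma (c + of_nat N) = pochhammer c N"
        by (subst pochhammer_rGamma[of c N]) (simp add: rGamma_inverse_Gamma Gamma_eq_zero_iff)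
      have "P (c - a) N * P (c - b) N / (P (c - a - b) N * P c N) * rGamma c *
        ((\<Sum>m. gauss_term a b (c + of_nat N) m) * Gamma (c + of_nat N)) =
        pochhammer (c - a) N * pochhammer (c - b) N * (\<Sum>m. gauss_term a b (c + of_nat N) m) / 
         (pochhammer (c - a - b) N * pochhammer c N) * (rGamma c * Gamma (c + of_nat N))"
        unfolding 1 by simp
      also have "\<dots> = (\<Sum>m. gauss_term a b c m)"
        unfolding 2 gauss_sum_iterate[OF abc, symmetric] using nz by simp
      finally show "P (c - a) N * P (c - b) N / (P (c - a - b) N * P c N) * rGamma c *
        ((\<Sum>m. gauss_term a b (c + of_nat N) m) * Gamma (c + of_nat N)) = (\<Sum>m. gauss_term a b c m)" .
    qed
    finally have "(\<Sum>m. gauss_term a b c m) = rGamma (c - a) * rGamma (c - b) / (rGamma (c - a - b) * rGamma c) * rGamma c * 1"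
      by (simp add: LIMSEQ_const_iff)
    then show ?thesis
      using npos by (simp add: rGamma_eq_zero_iff Gamma_def field_simps)
  qed
  \<comment> \<open>For general c, N contiguous steps lead to c + N in the right half-plane; the
    Pochhammer symbols produced on the way are absorbed by the functional equations of
    \<open>Gamma\<close> and \<open>rGamma\<close>.\<close>
  obtain N :: nat where N: "Re c + real N > 0"
    using ex_Re_add_nat_pos by blast
  have nz: "pochhammer (c - a - b) N \<noteq> 0" and npos: "c - a - b \<notin> \<int>\<^sub>\<le>\<^sub>0"
    using assms pochhammer_eq_0_imp_nonpos_Int[of "c - a - b" N]
    by (auto elim!: nonpos_Ints_cases simp: complex_eq_iff)
  have "pochhammer (c - a - b) N * (\<Sum>m. gauss_term a b c m) = pochhammer (c - a) N * pochhammer (c - b) N *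
     (Gamma (c + of_nat N - a - b) * rGamma (c + of_nat N - a) * rGamma (c + of_nat N - b))"
    unfolding gauss_sum_iterate[OF assms] by (subst pos) (use N assms in auto)
  also have "\<dots> = Gamma (c - a - b + of_nat N) * (pochhammer (c - a) N * rGamma (c - a + of_nat N)) *
      (pochhammer (c - b) N * rGamma (c - b + of_nat N))"
    by (simp add: algebra_simps)
  also have "\<dots> = (pochhammer (c - a - b) N * Gamma (c - a - b)) * rGamma (c - a) * rGamma (c - b)"
    unfolding pochhammer_rGamma[symmetric] using npos
    by (simp add: pochhammer_Gamma Gamma_eq_zero_iff)
  finally show ?thesis
    using nz by simp
qed

subsection \<open>Parametric integrals and the complex Beta integral\<close>

text \<open>Every disc of radius r/2 around a point of the half-size ball stays inside the big disc,
  so Cauchy's inequality bounds the derivative there by 2B/r; the mean value estimate then bounds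
  the quotient.\<close>

lemma norm_difference_quotient_le:
  fixes g :: "complex \<Rightarrow> complex"
  assumes hol: "g holomorphic_on U" and U: "cball w0 r \<subseteq> U" "open U" and r: "r > 0"
    and bd: "\<And>w. w \<in> cball w0 r \<Longrightarrow> norm (g w) \<le> B"
    and w: "w \<in> ball w0 (r / 2)" "w \<noteq> w0"
  shows "norm ((g w - g w0) / (w - w0)) \<le> 2 * B / r"
proof -
  have "norm (g w - g w0) \<le> (2 * B / r) * norm (w - w0)"
  proof (rule field_differentiable_bound)
    show "convex (ball w0 (r / 2))" by simp
    show "w \<in> ball w0 (r / 2)" "w0 \<in> ball w0 (r / 2)"
      using w r by auto
    fix z assume z: "z \<in> ball w0 (r / 2)"
    then have sub: "cball z (r / 2) \<subseteq> cball w0 r"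
      using cball_trans[of z w0 "r/2"] by (auto simp: dist_commute) (smt (verit) dist_commute dist_triangle2 field_sum_of_halves)
    then have zU: "cball z (r / 2) \<subseteq> U"
      using U by blast
    then have "z \<in> U"
      using r by auto
    then show "(g has_field_derivative deriv g z) (at z within ball w0 (r / 2))"
      using hol U(2) holomorphic_derivI by blast
    have "norm ((deriv ^^ 1) g z) \<le> fact 1 * B / (r / 2) ^ 1"
    proof (rule Cauchy_inequality)
      show "g holomorphic_on ball z (r / 2)"
        using hol zU ball_subset_cball holomorphic_on_subset by blast
      show "continuous_on (cball z (r / 2)) g"
        using hol zU holomorphic_on_imp_continuous_on holomorphic_on_subset by blast
      show "norm (g x) \<le> B" if "norm (z - x) = r / 2" for x
        using that sub by (intro bd) (auto simp: dist_norm)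
    qed (use r in auto)
    then show "norm (deriv g z) \<le> 2 * B / r"
      by (simp add: field_simps)
  qed
  then show ?thesis
    using w by (simp add: norm_divide field_simps)
qed

text \<open>Dominated convergence for difference quotients. A local majorant of the integrand itself
  suffices, since \<open>norm_difference_quotient_le\<close> turns it into a majorant of the
  quotients.\<close>

lemma holomorphic_on_parametric_integral:
  fixes f :: "complex \<Rightarrow> 'a \<Rightarrow> complex"
  assumes U: "open U"
    and meas: "\<And>w. w \<in> U \<Longrightarrow> f w \<in> borel_measurable M"
    and hol: "\<And>x. x \<in> space M \<Longrightarrow> (\<lambda>w. f w x) holomorphic_on U"
    and dom: "\<And>w0. w0 \<in> U \<Longrightarrow> \<exists>r>0. \<exists>G. cball w0 r \<subseteq> U \<and> integrable M G \<and>
                (\<forall>w\<in>cball w0 r. \<forall>x\<in>space M. norm (f w x) \<le> G x)"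
  shows "(\<lambda>w. \<integral>x. f w x \<partial>M) holomorphic_on U"
proof (subst holomorphic_on_open[OF U], intro ballI)
  fix w0 assume w0: "w0 \<in> U"
  obtain r G where r: "r > 0" "cball w0 r \<subseteq> U" and G: "integrable M G"
    and bd: "\<And>w x. w \<in> cball w0 r \<Longrightarrow> x \<in> space M \<Longrightarrow> norm (f w x) \<le> G x"
    using dom[OF w0] by blast
  have int: "integrable M (f w)" if "w \<in> cball w0 r" for w
    using that r bd by (intro Bochner_Integration.integrable_bound[OF G] meas AE_I2) (auto, fastforce)
  define D where "D x = deriv (\<lambda>w. f w x) w0" for x
  have "((\<lambda>w. ((\<integral>x. f w x \<partial>M) - (\<integral>x. f w0 x \<partial>M)) / (w - w0)) \<longlongrightarrow> (\<integral>x. D x \<partial>M)) (at w0)"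
    unfolding tendsto_at_iff_sequentially
  proof (intro allI impI)
    fix X assume X: "\<forall>i. X i \<in> UNIV - {w0}" "X \<longlonglongrightarrow> w0"
    have "eventually (\<lambda>n. X n \<in> ball w0 (r / 2)) sequentially"
      using X(2) r(1) by (intro topological_tendstoD) auto
    then obtain N where N: "\<And>n. n \<ge> N \<Longrightarrow> X n \<in> ball w0 (r / 2)"
      by (auto simp: eventually_sequentially)
    \<comment> \<open>Dropping the first N members puts the whole sequence into the half-size ball,
      so that the majorant holds for every n.\<close>
    define q where "q n x = (f (X (n + N)) x - f w0 x) / (X (n + N) - w0)" for n x
    have XU: "X (n + N) \<in> cball w0 r" for n
      using N[of "n + N"] r by auto
    have [measurable]: "f (X (n + N)) \<in> borel_measurable M" "f w0 \<in> borel_measurable M" for n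
      using XU[of n] r w0 by (auto intro!: meas)
    have qm: "q n \<in> borel_measurable M" for n
      unfolding q_def by measurable
    have lim: "(\<lambda>n. q n x) \<longlonglongrightarrow> D x" if x: "x \<in> space M" for x
    proof -
      have "((\<lambda>w. f w x) has_field_derivative D x) (at w0)"
        unfolding D_def using hol[OF x] U w0 holomorphic_derivI by blast
      then have "((\<lambda>w. (f w x - f w0 x) / (w - w0)) \<longlongrightarrow> D x) (at w0)"
        by (simp add: has_field_derivative_iff)
      then have "(\<lambda>n. (f (X n) x - f w0 x) / (X n - w0)) \<longlonglongrightarrow> D x"
        using X unfolding tendsto_at_iff_sequentially by (auto simp: o_def)
      then show ?thesis
        unfolding q_def by (rule LIMSEQ_ignore_initial_segment)
    qed
    have "(\<lambda>n. \<integral>x. q n x \<partial>M) \<longlonglongrightarrow> (\<integral>x. D x \<partial>M)"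
    proof (rule integral_dominated_convergence[where w = "\<lambda>x. 2 * G x / r"])
      show "D \<in> borel_measurable M"
        by (rule borel_measurable_LIMSEQ_metric[OF qm lim])
      show "integrable M (\<lambda>x. 2 * G x / r)"
        using G by simp
      show "AE x in M. (\<lambda>n. q n x) \<longlonglongrightarrow> D x"
        using lim by auto
      show "AE x in M. norm (q n x) \<le> 2 * G x / r" for n
        unfolding q_def using X(1) N[of "n + N"]
        by (intro AE_I2 norm_difference_quotient_le[OF hol r(2) U r(1)] bd) auto
    qed (rule qm)
    also have "(\<lambda>n. \<integral>x. q n x \<partial>M) = (\<lambda>n. ((\<integral>x. f (X (n + N)) x \<partial>M) - (\<integral>x. f w0 x \<partial>M)) / (X (n + N) - w0))"
      unfolding q_def using int XU r(1) by (simp add: Bochner_Integration.integral_diff)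
    finally show "((\<lambda>w. ((\<integral>x. f w x \<partial>M) - (\<integral>x. f w0 x \<partial>M)) / (w - w0)) \<circ> X) \<longlonglongrightarrow> (\<integral>x. D x \<partial>M)"
      unfolding o_def by (rule LIMSEQ_offset)
  qed
  then show "\<exists>f'. ((\<lambda>w. \<integral>x. f w x \<partial>M) has_field_derivative f') (at w0)"
    by (auto simp: has_field_derivative_iff)
qed

section \<open>The Beta integral with complex parameters\<close>

abbreviation unit_measure :: "real measure" where
  "unit_measure \<equiv> restrict_space lborel {0<..<1}"

lemma borel_measurable_unit_measure:
  fixes f :: "real \<Rightarrow> 'a :: topological_space"
  assumes "continuous_on {0<..<1} f"
  shows "f \<in> borel_measurable unit_measure"
proof -
  have "f \<in> borel_measurable (restrict_space borel {0<..<1})"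
    using assms by (rule borel_measurable_continuous_on_restrict)
  then show ?thesis
    by (simp cong: measurable_cong_sets add: sets_restrict_space)
qed

lemma Beta_integral_unit_measure_real:
  fixes a b :: real
  assumes "a > 0" "b > 0"
  shows "integrable unit_measure (\<lambda>t. t powr (a - 1) * (1 - t) powr (b - 1))"
    and "(\<integral>t. t powr (a - 1) * (1 - t) powr (b - 1) \<partial>unit_measure) = Beta a b"
proof -
  let ?f = "\<lambda>t::real. t powr (a - 1) * (1 - t) powr (b - 1)"
  have int: "set_integrable lborel {0<..<1} ?f"
    by (rule set_integrable_subset[OF integrable_Beta[OF assms]]) auto
  then show "integrable unit_measure ?f"
    by (simp add: integrable_restrict_space set_integrable_def)
  have "(?f has_integral Beta a b) {0<..<1}"
    using has_integral_Beta_real[OF assms] by (simp add: has_integral_Icc_iff_Ioo)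
  then show "(\<integral>t. ?f t \<partial>unit_measure) = Beta a b"
    using set_borel_integral_eq_integral(2)[OF int]
    by (simp add: integral_restrict_space set_lebesgue_integral_def integral_unique)
qed

lemma norm_Beta_integrand:
  assumes "t \<in> {0<..<1}"
  shows "norm (of_real t powr (a - 1) * of_real (1 - t) powr (b - 1) :: complex) =
    t powr (Re a - 1) * (1 - t) powr (Re b - 1)"
  using assms by (simp add: norm_mult norm_powr_real_powr del: of_real_diff)

lemma continuous_on_Beta_integrand:
  "continuous_on {0<..<1} (\<lambda>t::real. of_real t powr (a - 1) * of_real (1 - t) powr (b - 1) :: complex)"
  by (intro continuous_intros) (auto simp: complex_nonpos_Reals_iff)

lemma integrable_Beta_complex:
  fixes a b :: complex
  assumes "Re a > 0" "Re b > 0"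
  shows "integrable unit_measure (\<lambda>t. of_real t powr (a - 1) * of_real (1 - t) powr (b - 1))"
  by (rule Bochner_Integration.integrable_bound[OF Beta_integral_unit_measure_real(1)[OF assms]])
     (auto intro!: borel_measurable_unit_measure continuous_on_Beta_integrand AE_I2
        simp: space_restrict_space norm_Beta_integrand simp del: of_real_diff)

lemma Beta_integral_complex:
  fixes a b :: complex
  assumes "Re a > 0" "Re b > 0"
  shows "(\<integral>t. of_real t powr (a - 1) * of_real (1 - t) powr (b - 1) \<partial>unit_measure) = Beta a b"
proof -
  \<comment> \<open>Both parameters are moved along a complex line: they are real for real \<open>z\<close>, and
      \<open>z = \<i>\<close> gives back \<open>a\<close> and \<open>b\<close>.\<close>
  define p where "p z = of_real (Re a) + z * of_real (Im a)" for z :: complex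
  define q where "q z = of_real (Re b) + z * of_real (Im b)" for z :: complex
  define U where "U = {z. Re (p z) > 0} \<inter> {z. Re (q z) > 0}"
  define F where "F z = (\<integral>t. of_real t powr (p z - 1) * of_real (1 - t) powr (q z - 1) \<partial>unit_measure)" for z
  have Re: "Re (p z) = Re a + Im a * Re z" "Re (q z) = Re b + Im b * Re z" for z
    by (simp_all add: p_def q_def)
  have "open {z. Re (p z) > x}" "open {z. Re (q z) > x}" for x
    unfolding p_def q_def by (intro open_Collect_less continuous_intros)+
  note op = this
  have U: "open U"
    unfolding U_def using op by blast
  have "convex {z :: complex. 0 < u + v * Re z}" for u v
  proof -
    have "{z :: complex. 0 < u + v * Re z} = {z. inner (of_real v) z > - u}"
      by (auto simp: inner_complex_def)
    then show ?thesis
      by (simp only: convex_halfspace_gt)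
  qed
  then have "convex {z. Re (p z) > 0}" "convex {z. Re (q z) > 0}"
    by (simp_all only: Re)
  then have "convex U"
    unfolding U_def by (rule convex_Int)
  then have conn: "connected U"
    by (rule convex_connected)
  have U0: "0 \<in> U" "\<i> \<in> U"
    using assms by (auto simp: U_def Re)
  have "F holomorphic_on U"
    unfolding F_def
  proof (rule holomorphic_on_parametric_integral[OF U])
    fix w
    show "(\<lambda>t. complex_of_real t powr (p w - 1) * complex_of_real (1 - t) powr (q w - 1)) \<in> borel_measurable unit_measure"
      by (intro borel_measurable_unit_measure continuous_on_Beta_integrand)
  next
    fix t
    show "(\<lambda>w. complex_of_real t powr (p w - 1) * complex_of_real (1 - t) powr (q w - 1)) holomorphic_on U"
      unfolding p_def q_def by (intro holomorphic_intros)
  next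
    fix w0 assume w0: "w0 \<in> U"
    \<comment> \<open>Half the real parts at \<open>w0\<close> remain lower bounds on a small disc.
      On (0,1) smaller exponents give larger powers, so the real Beta integrand with exponents x and
      y is a majorant there.\<close>
    define x where "x = Re (p w0) / 2"
    define y where "y = Re (q w0) / 2"
    have xy: "x > 0" "y > 0"
      using w0 by (auto simp: x_def y_def U_def)
    have "open ({z. Re (p z) > x} \<inter> {z. Re (q z) > y})"
      using op by blast
    moreover have "w0 \<in> {z. Re (p z) > x} \<inter> {z. Re (q z) > y}"
      using w0 by (auto simp: x_def y_def U_def)
    ultimately obtain r where r: "r > 0" "cball w0 r \<subseteq> {z. Re (p z) > x} \<inter> {z. Re (q z) > y}"
      by (meson open_contains_cball)
    show "\<exists>r>0. \<exists>G. cball w0 r \<subseteq> U \<and> integrable unit_measure G \<and>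
       (\<forall>w\<in>cball w0 r. \<forall>t\<in>space unit_measure.
         norm (complex_of_real t powr (p w - 1) * complex_of_real (1 - t) powr (q w - 1)) \<le> G t)"
    proof (intro exI[of _ r] conjI exI[of _ "\<lambda>t. t powr (x - 1) * (1 - t) powr (y - 1)"] ballI)
      show "cball w0 r \<subseteq> U"
        using r(2) xy by (auto simp: U_def)
      show "integrable unit_measure (\<lambda>t. t powr (x - 1) * (1 - t) powr (y - 1))"
        by (rule Beta_integral_unit_measure_real[OF xy])
      fix w t assume wt: "w \<in> cball w0 r" "t \<in> space unit_measure"
      then have t: "t \<in> {0<..<1}"
        by (simp add: space_restrict_space)
      have "Re (p w) > x" "Re (q w) > y"
        using wt(1) r(2) by auto
      then have "t powr (Re (p w) - 1) * (1 - t) powr (Re (q w) - 1) \<le> t powr (x - 1) * (1 - t) powr (y - 1)"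
        using t by (intro mult_mono powr_mono') auto
      then show "norm (complex_of_real t powr (p w - 1) * complex_of_real (1 - t) powr (q w - 1)) \<le>
         t powr (x - 1) * (1 - t) powr (y - 1)"
        by (simp only: norm_Beta_integrand[OF t])
    qed (use r in auto)
  qed
  moreover have "(\<lambda>z. Beta (p z) (q z)) holomorphic_on U"
    unfolding p_def q_def
  proof (intro holomorphic_intros)
    show "complex_of_real (Re a) + z * complex_of_real (Im a) \<notin> \<int>\<^sub>\<le>\<^sub>0"
         "complex_of_real (Re b) + z * complex_of_real (Im b) \<notin> \<int>\<^sub>\<le>\<^sub>0" if "z \<in> U" for z
      using that by (auto simp: U_def p_def q_def elim!: nonpos_Ints_cases simp: complex_eq_iff)
  qed
  \<comment> \<open>The difference is holomorphic on the convex set \<open>U\<close> and vanishes at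
    its real points by the real Beta integral. These accumulate at 0, so it vanishes at \<i> as
    well.\<close>
  ultimately have hol: "(\<lambda>z. F z - Beta (p z) (q z)) holomorphic_on U"
    by (rule holomorphic_on_diff)
  have lim: "(0::complex) islimpt (U \<inter> \<real>)"
    unfolding islimpt_approachable
  proof (intro allI impI)
    fix e :: real assume "e > 0"
    obtain d where d: "d > 0" "ball 0 d \<subseteq> U"
      using U U0(1) open_contains_ball by blast
    then show "\<exists>x'\<in>U \<inter> \<real>. x' \<noteq> 0 \<and> dist x' 0 < e"
      using \<open>e > 0\<close> by (intro bexI[of _ "of_real (min d e / 2)"]) (auto simp: subset_iff)
  qed
  have "F \<i> - Beta (p \<i>) (q \<i>) = 0"
  proof (rule analytic_continuation[OF hol U conn _ U0(1) lim _ U0(2)])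
    fix z assume z: "z \<in> U \<inter> \<real>"
    then obtain s where s: "z = of_real s"
      by (auto elim: Reals_cases)
    define x where "x = Re a + s * Im a"
    define y where "y = Re b + s * Im b"
    have pq: "p z = of_real x" "q z = of_real y"
      by (simp_all add: p_def q_def s x_def y_def)
    have xy: "x > 0" "y > 0"
      using z by (auto simp: U_def pq)
    have "F z = (\<integral>t. complex_of_real (t powr (x - 1) * (1 - t) powr (y - 1)) \<partial>unit_measure)"
      unfolding F_def pq
    proof (rule Bochner_Integration.integral_cong)
      fix t assume "t \<in> space unit_measure"
      then have "0 \<le> t" "0 \<le> 1 - t"
        by (auto simp: space_restrict_space)
      then show "complex_of_real t powr (of_real x - 1) * complex_of_real (1 - t) powr (of_real y - 1) =
          of_real (t powr (x - 1) * (1 - t) powr (y - 1))"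
        using powr_of_real[of t "x - 1"] powr_of_real[of "1 - t" "y - 1"] by simp
    qed simp
    also have "\<dots> = of_real (Beta x y)"
      using Beta_integral_unit_measure_real(2)[OF xy] by (simp only: integral_complex_of_real)
    finally show "F z - Beta (p z) (q z) = 0"
      by (simp add: pq Beta_complex_of_real)
  qed auto
  moreover have "p \<i> = a" "q \<i> = b"
    by (simp_all add: p_def q_def complex_eq_iff)
  ultimately show ?thesis
    by (simp add: F_def)
qed

subsection \<open>Beta integrals of hypergeometric series\<close>

abbreviation fps_2F1 :: "complex \<Rightarrow> complex \<Rightarrow> complex \<Rightarrow> complex fps" where
  "fps_2F1 a b c \<equiv> fps_hypergeo [a, b] [c] 1"

lemma not_nonpos_Int_if_Re_pos: "Re z > 0 \<Longrightarrow> z \<notin> \<int>\<^sub>\<le>\<^sub>0"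
  by (auto elim!: nonpos_Ints_cases simp: complex_eq_iff)

lemma pochhammer_nonzero: "(z :: complex) \<notin> \<int>\<^sub>\<le>\<^sub>0 \<Longrightarrow> pochhammer z n \<noteq> 0"
  using pochhammer_eq_0_imp_nonpos_Int by blast

lemma rGamma_mult_Gamma: "(z :: complex) \<notin> \<int>\<^sub>\<le>\<^sub>0 \<Longrightarrow> rGamma z * Gamma z = 1"
  by (simp add: rGamma_inverse_Gamma Gamma_eq_zero_iff)

lemma fps_2F1_nth_gauss_term:
  assumes "c \<notin> \<int>\<^sub>\<le>\<^sub>0"
  shows "fps_nth (fps_2F1 a b c) n = gauss_term a b c n * Gamma c"
proof -
  have "Gamma c * rGamma c = 1"
    using rGamma_mult_Gamma[OF assms] by (simp add: mult.commute)
  then have "Gamma c * (pochhammer c n * rGamma (c + of_nat n)) = 1"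
    by (simp only: pochhammer_rGamma[symmetric])
  then show ?thesis
    using pochhammer_nonzero[OF assms, of n] by (simp add: gauss_term_def field_simps)
qed

text \<open>The coefficients grow at most polynomially, which the geometric factor r^n with r < 1
  outweighs.\<close>

lemma fps_conv_radius_2F1:
  assumes "c \<notin> \<int>\<^sub>\<le>\<^sub>0"
  shows "fps_conv_radius (fps_2F1 a b c) \<ge> 1"
  unfolding fps_conv_radius_def
proof (rule conv_radius_geI_ex')
  fix r :: real assume r: "0 < r" "ereal r < 1"
  define k where "k = Re (a + b - c) - 1"
  show "summable (\<lambda>n. fps_nth (fps_2F1 a b c) n * of_real r ^ n)"
  proof (rule summable_norm_cancel, rule summable_comparison_test_bigo)
    show "summable (\<lambda>n. norm (real n powr (-2)))"
      by (simp add: summable_real_powr_iff)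
    have "(\<lambda>n. norm (Gamma c)) \<in> O(\<lambda>_. 1 :: real)"
      by simp
    then have "(\<lambda>n. norm (gauss_term a b c n) * norm (Gamma c) * r ^ n) \<in> O(\<lambda>n. real n powr k * 1 * r ^ n)"
      unfolding k_def by (intro landau_o.big.mult norm_gauss_term_bigo landau_o.big_refl)
    also have "(\<lambda>n. norm (gauss_term a b c n) * norm (Gamma c) * r ^ n) =
       (\<lambda>n. norm (fps_nth (fps_2F1 a b c) n * of_real r ^ n))"
      using r unfolding fps_2F1_nth_gauss_term[OF assms] by (simp add: norm_mult norm_power)
    also have "(\<lambda>n. real n powr k * 1 * r ^ n) \<in> O(\<lambda>n. real n powr (-2))"
      using r by real_asymp
    finally show "(\<lambda>n. norm (fps_nth (fps_2F1 a b c) n * of_real r ^ n)) \<in> O(\<lambda>n. real n powr (-2))" .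
  qed
qed

lemma norm_less_conv_radius_2F1:
  "c \<notin> \<int>\<^sub>\<le>\<^sub>0 \<Longrightarrow> norm z < 1 \<Longrightarrow> ereal (norm z) < fps_conv_radius (fps_2F1 a b c)"
  using less_le_trans[OF _ fps_conv_radius_2F1, of "ereal (norm z)" c a b] by simp

text \<open>Termwise integration: the Beta integral of the m-th term brings in Gamma(C+m), which
  cancels (C)_m up to Gamma(C), and what remains is a Gauss series with lower parameter C +
  \<alpha>. The last hypothesis is the convergence condition of that series.\<close>

lemma Beta_integral_2F1:
  assumes C: "Re C > 0" and \<alpha>: "Re \<alpha> > 0" and ab: "Re (\<alpha> + C - a - b) > 0"
  shows "integrable unit_measure (\<lambda>u. of_real u powr (C - 1) * of_real (1 - u) powr (\<alpha> - 1) *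
           eval_fps (fps_2F1 a b C) (of_real u))" (is "integrable _ ?g")
    and "(\<integral>u. of_real u powr (C - 1) * of_real (1 - u) powr (\<alpha> - 1) *
           eval_fps (fps_2F1 a b C) (of_real u) \<partial>unit_measure) =
         Gamma C * Gamma \<alpha> * Gamma (\<alpha> + C - a - b) * rGamma (\<alpha> + C - a) * rGamma (\<alpha> + C - b)"
proof -
  define e where "e m = fps_nth (fps_2F1 a b C) m" for m
  define h where "h m u = e m * (of_real u powr (C + of_nat m - 1) * of_real (1 - u) powr (\<alpha> - 1))" for m and u :: real
  have Cn: "C \<notin> \<int>\<^sub>\<le>\<^sub>0"
    using C by (rule not_nonpos_Int_if_Re_pos)
  have Cm: "Re (C + of_nat m) > 0" for m
    using C by simp
  have h_eq: "h m u = of_real u powr (C - 1) * of_real (1 - u) powr (\<alpha> - 1) * (e m * of_real u ^ m)"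
    if "u \<in> {0<..<1}" for m u
  proof -
    have "complex_of_real u powr (C + of_nat m - 1) = of_real u powr (C - 1) * of_real u powr (of_nat m)"
      unfolding powr_add[symmetric] by (simp add: algebra_simps)
    then show ?thesis
      using that by (simp add: h_def mult_ac)
  qed
  have suminf_h: "(\<Sum>m. h m u) = ?g u" and summ_h: "summable (\<lambda>m. norm (h m u))" if u: "u \<in> {0<..<1}" for u
  proof -
    have rad: "ereal (norm (complex_of_real u)) < fps_conv_radius (fps_2F1 a b C)"
      using u by (intro norm_less_conv_radius_2F1[OF Cn]) auto
    then have "summable (\<lambda>m. norm (e m * of_real u ^ m))"
      unfolding e_def fps_conv_radius_def by (rule abs_summable_in_conv_radius)
    then show "summable (\<lambda>m. norm (h m u))" "(\<Sum>m. h m u) = ?g u"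
      unfolding h_eq[OF u] eval_fps_def e_def[symmetric]
      by (auto simp: norm_mult mult.assoc summable_mult suminf_mult[OF summable_norm_cancel])
  qed
  have int_h: "integrable unit_measure (h m)" for m
    unfolding h_def using integrable_Beta_complex[OF Cm \<alpha>] by simp
  have val_h: "(\<integral>u. h m u \<partial>unit_measure) = Gamma C * Gamma \<alpha> * gauss_term a b (C + \<alpha>) m" for m
  proof -
    have "(\<integral>u. h m u \<partial>unit_measure) = e m * Beta (C + of_nat m) \<alpha>"
      unfolding h_def using Beta_integral_complex[OF Cm \<alpha>] by simp
    also have "\<dots> = Gamma C * Gamma \<alpha> * gauss_term a b (C + \<alpha>) m"
      using pochhammer_nonzero[OF Cn, of m] Cn
      by (simp add: Beta_altdef gauss_term_def e_def pochhammer_Gamma Gamma_eq_zero_iff add_ac field_simps)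
    finally show ?thesis .
  qed
  \<comment> \<open>The interchange of sum and integral needs the integrals of the norms, which are
    real Beta integrals in Re C + m and Re \<alpha>. As |(C)_m| is at least (Re C)_m, they are
    bounded by a multiple of the Gauss terms with lower parameter Re C + Re \<alpha>.\<close>
  have sums_h: "summable (\<lambda>m. \<integral>u. norm (h m u) \<partial>unit_measure)"
  proof (rule summable_comparison_test)
    let ?r = "complex_of_real (Re C + Re \<alpha>)"
    show "summable (\<lambda>m. Gamma (Re C) * Gamma (Re \<alpha>) * norm (gauss_term a b ?r m))"
      using ab by (intro summable_mult summable_norm_gauss_term) (simp add: algebra_simps)
    show "\<exists>N. \<forall>m\<ge>N. norm (\<integral>u. norm (h m u) \<partial>unit_measure) \<le> Gamma (Re C) * Gamma (Re \<alpha>) * norm (gauss_term a b ?r m)"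
    proof (intro exI[of _ 0] allI impI)
      fix m
      have "(\<integral>u. norm (h m u) \<partial>unit_measure) =
         (\<integral>u. norm (e m) * (u powr (Re C + real m - 1) * (1 - u) powr (Re \<alpha> - 1)) \<partial>unit_measure)"
        by (rule Bochner_Integration.integral_cong)
           (simp_all add: h_def space_restrict_space norm_mult[of "e m"] norm_Beta_integrand del: of_real_diff)
      also have "\<dots> = norm (e m) * Beta (Re C + real m) (Re \<alpha>)"
        using Beta_integral_unit_measure_real[of "Re C + real m" "Re \<alpha>"] C \<alpha> by simp
      also have "\<dots> = norm (pochhammer a m * pochhammer b m / fact m) * (pochhammer (Re C) m / norm (pochhammer C m)) *
          (Gamma (Re C) * Gamma (Re \<alpha>) * rGamma (Re C + Re \<alpha> + real m))"
      proof -
        have "Re C \<notin> \<int>\<^sub>\<le>\<^sub>0"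
          using C by (auto elim!: nonpos_Ints_cases)
        then have "Gamma (Re C + real m) = pochhammer (Re C) m * Gamma (Re C)"
          by (simp add: pochhammer_Gamma Gamma_eq_zero_iff)
        then show ?thesis
          by (simp add: Beta_altdef e_def norm_mult norm_divide add_ac mult_ac)
      qed
      also have "\<dots> \<le> norm (pochhammer a m * pochhammer b m / fact m) * 1 *
          (Gamma (Re C) * Gamma (Re \<alpha>) * rGamma (Re C + Re \<alpha> + real m))"
      proof (intro mult_right_mono mult_left_mono)
        show "pochhammer (Re C) m / norm (pochhammer C m) \<le> 1"
          using pochhammer_Re_le_norm[of "Re C" C m] C by (intro divide_le_eq_1[THEN iffD2]) (auto simp: pochhammer_nonzero Cn)
        show "0 \<le> Gamma (Re C) * Gamma (Re \<alpha>) * rGamma (Re C + Re \<alpha> + real m)"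
          using C \<alpha> by (auto intro!: mult_nonneg_nonneg less_imp_le[OF Gamma_real_pos] simp: rGamma_inverse_Gamma)
      qed auto
      also have "rGamma (Re C + Re \<alpha> + real m) = norm (rGamma (?r + of_nat m))"
      proof -
        have "norm (rGamma (?r + of_nat m)) = \<bar>rGamma (Re C + Re \<alpha> + real m)\<bar>"
          using rGamma_complex_of_real[of "Re C + Re \<alpha> + real m"] by simp
        also have "\<dots> = rGamma (Re C + Re \<alpha> + real m)"
          using C \<alpha> by (auto intro!: abs_of_nonneg less_imp_le[OF Gamma_real_pos] simp: rGamma_inverse_Gamma)
        finally show ?thesis ..
      qed
      finally have "(\<integral>u. norm (h m u) \<partial>unit_measure) \<le> Gamma (Re C) * Gamma (Re \<alpha>) * norm (gauss_term a b ?r m)"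
        by (simp add: gauss_term_def norm_mult norm_divide mult_ac)
      then show "norm (\<integral>u. norm (h m u) \<partial>unit_measure) \<le> Gamma (Re C) * Gamma (Re \<alpha>) * norm (gauss_term a b ?r m)"
        by simp
    qed
  qed
  have AE: "AE u in unit_measure. summable (\<lambda>m. norm (h m u))"
    using summ_h by (intro AE_I2) (simp add: space_restrict_space)
  have sp: "u \<in> space unit_measure \<Longrightarrow> u \<in> {0<..<1}" for u
    by (simp add: space_restrict_space)
  have "integrable unit_measure (\<lambda>u. \<Sum>m. h m u)"
    by (rule integrable_suminf[OF int_h AE sums_h])
  then show "integrable unit_measure ?g"
    using suminf_h sp by (subst Bochner_Integration.integrable_cong[OF refl, of _ _ "\<lambda>u. \<Sum>m. h m u"]) (auto simp: suminf_h)
  have "(\<integral>u. ?g u \<partial>unit_measure) = (\<integral>u. (\<Sum>m. h m u) \<partial>unit_measure)"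
    using suminf_h sp by (intro Bochner_Integration.integral_cong) auto
  also have "\<dots> = (\<Sum>m. Gamma C * Gamma \<alpha> * gauss_term a b (C + \<alpha>) m)"
    by (subst integral_suminf[OF int_h AE sums_h]) (simp add: val_h)
  also have "\<dots> = Gamma C * Gamma \<alpha> * (\<Sum>m. gauss_term a b (C + \<alpha>) m)"
    using ab by (intro suminf_mult summable_norm_cancel[OF summable_norm_gauss_term]) (simp add: algebra_simps)
  also have "(\<Sum>m. gauss_term a b (C + \<alpha>) m) = Gamma (C + \<alpha> - a - b) * rGamma (C + \<alpha> - a) * rGamma (C + \<alpha> - b)"
    using ab by (intro gauss_summation) (simp add: algebra_simps)
  finally show "(\<integral>u. ?g u \<partial>unit_measure) =
      Gamma C * Gamma \<alpha> * Gamma (\<alpha> + C - a - b) * rGamma (\<alpha> + C - a) * rGamma (\<alpha> + C - b)"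
    by (simp add: algebra_simps)
qed

subsection \<open>An integral transform on the slit plane\<close>

text \<open>In the notation of the introduction, \<open>A = \<delta> - \<beta>\<close>, \<open>B = \<delta> - \<alpha>\<close> and \<open>\<nu> = \<alpha> + \<beta> + C - \<delta>\<close>.\<close>

definition hyp_weight :: "complex \<Rightarrow> complex \<Rightarrow> complex \<Rightarrow> complex \<Rightarrow> real \<Rightarrow> complex" where
  "hyp_weight C \<alpha> \<beta> \<delta> u = of_real u powr (C - 1) * of_real (1 - u) powr (\<alpha> - 1) *
     eval_fps (fps_2F1 (\<delta> - \<beta>) (\<alpha> + C - \<delta>) C) (of_real u)"

text \<open>An integral representation of F(\<alpha>,\<beta>;\<delta>;w) up to gamma factors. The
  auxiliary C enters the value only through these factors (\<open>hyp_transform_eq\<close>): it is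
  the lower parameter of the integrand when an integral is to be evaluated, and can be chosen at
  will when only the continuation is wanted.\<close>

definition hyp_transform :: "complex \<Rightarrow> complex \<Rightarrow> complex \<Rightarrow> complex \<Rightarrow> complex \<Rightarrow> complex" where
  "hyp_transform C \<alpha> \<beta> \<delta> w =
     (\<integral>u. hyp_weight C \<alpha> \<beta> \<delta> u * (1 - w * of_real (1 - u)) powr (- (\<alpha> + \<beta> + C - \<delta>)) \<partial>unit_measure)"

text \<open>For the upper parameters a, b of the weight, \<alpha> + C - a - b equals \<beta>, so the
  conditions of \<open>Beta_integral_2F1\<close> become symmetric in \<alpha> and \<beta>.\<close>

lemma integrable_hyp_weight:
  assumes "Re C > 0" "Re \<alpha> > 0" "Re \<beta> > 0"
  shows "integrable unit_measure (hyp_weight C \<alpha> \<beta> \<delta>)"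
  unfolding hyp_weight_def using assms by (intro Beta_integral_2F1(1)) auto

section \<open>Geometry of the slit plane and the identity theorem on it\<close>

text \<open>If w v were a real number at least 1, then so would be w, because 0 < v \<le> 1. Hence
  the principal branch of the kernel is holomorphic in w throughout the slit plane.\<close>

lemma hyp_slit_plane_kernel:
  assumes "w \<in> hyp_slit_plane" "0 \<le> v" "v \<le> 1"
  shows "1 - w * complex_of_real v \<notin> \<real>\<^sub>\<le>\<^sub>0"
proof
  assume "1 - w * complex_of_real v \<in> \<real>\<^sub>\<le>\<^sub>0"
  then obtain x where x: "x \<le> 0" "1 - w * complex_of_real v = of_real x"
    by (auto elim!: nonpos_Reals_cases)
  then have wv: "w * of_real v = of_real (1 - x)"
    by (simp add: algebra_simps)
  with x(1) have "v \<noteq> 0"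
    by (auto simp: complex_eq_iff)
  then have "w = of_real ((1 - x) / v)"
    using wv by (simp add: field_simps)
  moreover have "(1 - x) / v \<ge> 1"
    using assms(2,3) \<open>v \<noteq> 0\<close> x(1) by (simp add: field_simps)
  ultimately show False
    using assms(1) unfolding hyp_slit_plane_def by blast
qed

lemma open_hyp_slit_plane: "open hyp_slit_plane"
proof -
  have "closed (complex_of_real ` {1..})"
    by (intro closed_injective_linear_image) (auto intro: linear_of_real inj_of_real simp: inj_on_def)
  then show ?thesis
    unfolding hyp_slit_plane_def by (simp add: open_Compl)
qed

lemma ball_subset_hyp_slit_plane: "ball 0 1 \<subseteq> hyp_slit_plane"
  by (auto simp: hyp_slit_plane_def)

lemma zero_in_hyp_slit_plane: "0 \<in> hyp_slit_plane"
  using ball_subset_hyp_slit_plane by auto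

lemma closed_segment_hyp_slit_plane:
  assumes "w \<in> hyp_slit_plane"
  shows "closed_segment 0 w \<subseteq> hyp_slit_plane"
proof
  fix z assume "z \<in> closed_segment 0 w"
  then obtain t where t: "0 \<le> t" "t \<le> 1" "z = w * of_real t"
    by (auto simp: in_segment scaleR_conv_of_real mult.commute)
  have "1 - z \<notin> \<real>\<^sub>\<le>\<^sub>0"
    unfolding t(3) by (rule hyp_slit_plane_kernel[OF assms t(1,2)])
  moreover have "1 - z \<in> \<real>\<^sub>\<le>\<^sub>0" if "z \<in> of_real ` {1..}"
    using that by (auto simp: complex_nonpos_Reals_iff)
  ultimately show "z \<in> hyp_slit_plane"
    by (auto simp: hyp_slit_plane_def)
qed

lemma starlike_hyp_slit_plane: "starlike hyp_slit_plane"
  unfolding starlike_def using closed_segment_hyp_slit_plane zero_in_hyp_slit_plane by blast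

lemma hyp_slit_plane_eqI:
  assumes "f holomorphic_on hyp_slit_plane" "g holomorphic_on hyp_slit_plane"
    and "eventually (\<lambda>z. f z = g z) (nhds 0)" "z \<in> hyp_slit_plane"
  shows "f z = g z"
proof -
  obtain s where s: "open s" "0 \<in> s" "\<And>z. z \<in> s \<Longrightarrow> f z = g z"
    using assms(3) by (auto simp: eventually_nhds)
  show ?thesis
  proof (rule analytic_continuation_open[of "s \<inter> hyp_slit_plane" hyp_slit_plane f g])
    show "open (s \<inter> hyp_slit_plane)"
      using s open_hyp_slit_plane by blast
    show "s \<inter> hyp_slit_plane \<noteq> {}"
      using s(2) zero_in_hyp_slit_plane by blast
    show "connected hyp_slit_plane"
      by (rule starlike_imp_connected[OF starlike_hyp_slit_plane])
  qed (use assms s open_hyp_slit_plane in auto)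
qed

lemma continuous_on_powr_const:
  fixes f :: "'a :: topological_space \<Rightarrow> complex"
  assumes "continuous_on S f" "\<And>x. x \<in> S \<Longrightarrow> f x \<notin> \<real>\<^sub>\<le>\<^sub>0"
  shows "continuous_on S (\<lambda>x. f x powr n)"
proof -
  have "continuous_on S (\<lambda>x. exp (n * Ln (f x)))"
    using assms by (intro continuous_intros) auto
  moreover have "exp (n * Ln (f x)) = f x powr n" if "x \<in> S" for x
    using assms(2)[OF that] by (auto simp: powr_def)
  ultimately show ?thesis
    by (subst (asm) continuous_on_cong[OF refl]) auto
qed

section \<open>Convergence, holomorphy and power series of the transform\<close>

text \<open>The kernel is continuous in v = 1 - u on the compact interval [0,1], end points
  included, hence bounded; the weight is integrable.\<close>

lemma hyp_transform_integrable:
  assumes "Re C > 0" "Re \<alpha> > 0" "Re \<beta> > 0" and w: "w \<in> hyp_slit_plane"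
  shows "integrable unit_measure (\<lambda>u. hyp_weight C \<alpha> \<beta> \<delta> u * (1 - w * of_real (1 - u)) powr n)"
proof -
  note g = integrable_hyp_weight[OF assms(1-3), of \<delta>]
  have [measurable]: "hyp_weight C \<alpha> \<beta> \<delta> \<in> borel_measurable unit_measure"
    using g by auto
  have [measurable]: "(\<lambda>u. (1 - w * of_real (1 - u)) powr n) \<in> borel_measurable unit_measure"
    using hyp_slit_plane_kernel[OF w]
    by (intro borel_measurable_unit_measure continuous_on_powr_const continuous_intros)
       (auto simp del: of_real_diff)
  have "continuous_on {0..1} (\<lambda>v. (1 - w * complex_of_real v) powr n)"
    using hyp_slit_plane_kernel[OF w] by (intro continuous_on_powr_const continuous_intros) auto
  then have "compact ((\<lambda>v. (1 - w * complex_of_real v) powr n) ` {0..1})"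
    by (intro compact_continuous_image) auto
  then obtain K where "\<forall>x\<in>(\<lambda>v. (1 - w * complex_of_real v) powr n) ` {0..1}. norm x \<le> K"
    using compact_imp_bounded bounded_iff by metis
  then have K: "\<And>v. v \<in> {0..1} \<Longrightarrow> norm ((1 - w * complex_of_real v) powr n) \<le> K"
    by auto
  show ?thesis
  proof (rule Bochner_Integration.integrable_bound)
    show "integrable unit_measure (\<lambda>u. norm (hyp_weight C \<alpha> \<beta> \<delta> u) * K)"
      using g by simp
    show "AE u in unit_measure. norm (hyp_weight C \<alpha> \<beta> \<delta> u * (1 - w * of_real (1 - u)) powr n) \<le>
       norm (norm (hyp_weight C \<alpha> \<beta> \<delta> u) * K)"
    proof (rule AE_I2)
      fix u assume "u \<in> space unit_measure"
      then have "norm ((1 - w * complex_of_real (1 - u)) powr n) \<le> K"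
        by (intro K) (auto simp: space_restrict_space)
      then have "norm ((1 - w * complex_of_real (1 - u)) powr n) \<le> \<bar>K\<bar>"
        by linarith
      then show "norm (hyp_weight C \<alpha> \<beta> \<delta> u * (1 - w * of_real (1 - u)) powr n) \<le>
         norm (norm (hyp_weight C \<alpha> \<beta> \<delta> u) * K)"
        by (simp add: norm_mult abs_mult mult_left_mono del: of_real_diff)
    qed
  qed measurable
qed

lemma hyp_transform_holomorphic:
  assumes "Re C > 0" "Re \<alpha> > 0" "Re \<beta> > 0"
  shows "hyp_transform C \<alpha> \<beta> \<delta> holomorphic_on hyp_slit_plane"
proof -
  define n where "n = - (\<alpha> + \<beta> + C - \<delta>)"
  note g = integrable_hyp_weight[OF assms, of \<delta>]
  have "(\<lambda>w. \<integral>u. hyp_weight C \<alpha> \<beta> \<delta> u * (1 - w * of_real (1 - u)) powr n \<partial>unit_measure) holomorphic_on hyp_slit_plane"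
  proof (rule holomorphic_on_parametric_integral[OF open_hyp_slit_plane])
    fix w assume w: "w \<in> hyp_slit_plane"
    show "(\<lambda>u. hyp_weight C \<alpha> \<beta> \<delta> u * (1 - w * of_real (1 - u)) powr n) \<in> borel_measurable unit_measure"
      by (rule borel_measurable_integrable[OF hyp_transform_integrable[OF assms w]])
  next
    fix u assume "u \<in> space unit_measure"
    then show "(\<lambda>w. hyp_weight C \<alpha> \<beta> \<delta> u * (1 - w * of_real (1 - u)) powr n) holomorphic_on hyp_slit_plane"
      using hyp_slit_plane_kernel
      by (intro holomorphic_intros) (auto simp: space_restrict_space simp del: of_real_diff)
  next
    fix w0 assume w0: "w0 \<in> hyp_slit_plane"
    obtain r where r: "r > 0" "cball w0 r \<subseteq> hyp_slit_plane"
      using open_hyp_slit_plane w0 open_contains_cball by blast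
    \<comment> \<open>Joint continuity on a compact product bounds the kernel uniformly in w and v,
      which makes a multiple of the weight a local majorant.\<close>
    have "continuous_on (cball w0 r \<times> {0..1}) (\<lambda>(w, v). (1 - w * complex_of_real v) powr n)"
      using r hyp_slit_plane_kernel unfolding case_prod_beta
      by (intro continuous_on_powr_const continuous_intros) auto
    then have "compact ((\<lambda>(w, v). (1 - w * complex_of_real v) powr n) ` (cball w0 r \<times> {0..1}))"
      by (intro compact_continuous_image compact_Times) auto
    then obtain K where "\<forall>x\<in>(\<lambda>(w, v). (1 - w * complex_of_real v) powr n) ` (cball w0 r \<times> {0..1}). norm x \<le> K"
      using compact_imp_bounded bounded_iff by metis
    then have K: "\<And>w v. w \<in> cball w0 r \<Longrightarrow> v \<in> {0..1} \<Longrightarrow> norm ((1 - w * complex_of_real v) powr n) \<le> K"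
      by auto
    show "\<exists>r>0. \<exists>G. cball w0 r \<subseteq> hyp_slit_plane \<and> integrable unit_measure G \<and>
       (\<forall>w\<in>cball w0 r. \<forall>u\<in>space unit_measure.
         norm (hyp_weight C \<alpha> \<beta> \<delta> u * (1 - w * of_real (1 - u)) powr n) \<le> G u)"
    proof (intro exI[of _ r] exI[of _ "\<lambda>u. norm (hyp_weight C \<alpha> \<beta> \<delta> u) * K"] conjI ballI)
      show "integrable unit_measure (\<lambda>u. norm (hyp_weight C \<alpha> \<beta> \<delta> u) * K)"
        using g by simp
      show "norm (hyp_weight C \<alpha> \<beta> \<delta> u * (1 - w * of_real (1 - u)) powr n) \<le> norm (hyp_weight C \<alpha> \<beta> \<delta> u) * K"
        if "w \<in> cball w0 r" "u \<in> space unit_measure" for w u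
        unfolding norm_mult using that
        by (intro mult_left_mono K) (auto simp: space_restrict_space)
    qed (use r in auto)
  qed
  then show ?thesis
    by (simp add: hyp_transform_def[abs_def] n_def)
qed

lemma one_minus_powr_sums:
  fixes z \<nu> :: complex
  assumes "norm z < 1"
  shows "(\<lambda>n. pochhammer \<nu> n / fact n * z ^ n) sums ((1 - z) powr (- \<nu>))"
    and "summable (\<lambda>n. norm (pochhammer \<nu> n / fact n * z ^ n))"
proof -
  have eq: "fps_nth (fps_binomial (- \<nu>)) n * (- z) ^ n = pochhammer \<nu> n / fact n * z ^ n" for n
  proof -
    have "(-1 :: complex) ^ n * (-1) ^ n = 1"
      by (simp flip: power_mult_distrib)
    then have "(-1) ^ n * pochhammer \<nu> n / fact n * ((-1) ^ n * z ^ n) = pochhammer \<nu> n / fact n * z ^ n"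
      by (simp add: field_simps)
    then show ?thesis
      by (simp add: gbinomial_pochhammer power_minus[of z])
  qed
  have rad: "ereal (norm (- z)) < fps_conv_radius (fps_binomial (- \<nu>))"
    using assms by (simp add: fps_conv_radius_binomial)
  from sums_eval_fps[OF rad] show "(\<lambda>n. pochhammer \<nu> n / fact n * z ^ n) sums ((1 - z) powr (- \<nu>))"
    unfolding eq using assms by (simp add: eval_fps_binomial)
  have "summable (\<lambda>n. norm (fps_nth (fps_binomial (- \<nu>)) n * (- z) ^ n))"
    using rad unfolding fps_conv_radius_def by (rule abs_summable_in_conv_radius)
  then show "summable (\<lambda>n. norm (pochhammer \<nu> n / fact n * z ^ n))"
    unfolding eq .
qed

text \<open>Expand the kernel by the binomial series. The factor (1-u)^n raises \<alpha> by n, and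
  \<open>Beta_integral_2F1\<close> yields \<Gamma>(\<alpha>+n) \<Gamma>(\<beta>+n) /
  (\<Gamma>(\<nu>+n) \<Gamma>(\<delta>+n)) up to \<Gamma>(C). The binomial coefficient carries
  (\<nu>)_n, and (\<nu>)_n / \<Gamma>(\<nu>+n) = 1/\<Gamma>(\<nu>) for every \<nu>.\<close>

lemma hyp_transform_series:
  assumes C: "Re C > 0" and \<alpha>: "Re \<alpha> > 0" and \<beta>: "Re \<beta> > 0" and \<delta>: "\<delta> \<notin> \<int>\<^sub>\<le>\<^sub>0"
    and w: "norm w < 1"
  shows "hyp_transform C \<alpha> \<beta> \<delta> w =
    Gamma C * Gamma \<alpha> * Gamma \<beta> * rGamma (\<alpha> + \<beta> + C - \<delta>) * rGamma \<delta> * eval_fps (fps_2F1 \<alpha> \<beta> \<delta>) w"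
proof -
  define \<nu> where "\<nu> = \<alpha> + \<beta> + C - \<delta>"
  define K where "K = Gamma C * Gamma \<alpha> * Gamma \<beta> * rGamma \<nu> * rGamma \<delta>"
  define k where "k n = pochhammer \<nu> n / fact n * w ^ n" for n
  define h where "h n u = k n * (hyp_weight C \<alpha> \<beta> \<delta> u * of_real (1 - u) ^ n)" for n u
  note g = integrable_hyp_weight[OF C \<alpha> \<beta>, of \<delta>]
  have sp: "u \<in> space unit_measure \<Longrightarrow> u \<in> {0<..<1}" for u
    by (simp add: space_restrict_space)
  have summ_k: "summable (\<lambda>n. norm (k n))"
    unfolding k_def by (rule one_minus_powr_sums(2)[OF w])
  have weight: "hyp_weight C \<alpha> \<beta> \<delta> u * of_real (1 - u) ^ n =
      of_real u powr (C - 1) * of_real (1 - u) powr (\<alpha> + of_nat n - 1) *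
        eval_fps (fps_2F1 (\<delta> - \<beta>) (\<alpha> + C - \<delta>) C) (of_real u)" if "u \<in> {0<..<1}" for u n
  proof -
    have "complex_of_real (1 - u) powr (\<alpha> + of_nat n - 1) = of_real (1 - u) powr (\<alpha> - 1) * of_real (1 - u) powr (of_nat n)"
      unfolding powr_add[symmetric] by (simp add: algebra_simps)
    also have "complex_of_real (1 - u) powr (of_nat n) = of_real (1 - u) ^ n"
      using that by (intro powr_complexpow) (auto simp del: of_real_diff)
    finally show ?thesis
      by (simp add: hyp_weight_def mult_ac)
  qed
  have bound: "norm (h n u) \<le> norm (k n) * norm (hyp_weight C \<alpha> \<beta> \<delta> u)" if u: "u \<in> {0<..<1}" for n u
  proof -
    have "norm (complex_of_real (1 - u) ^ n) \<le> 1"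
      using u by (auto simp: norm_power intro!: power_le_one simp del: of_real_diff)
    then show ?thesis
      unfolding h_def norm_mult[of "k n"] norm_mult[of "hyp_weight C \<alpha> \<beta> \<delta> u"]
      by (intro mult_left_mono mult_left_le) auto
  qed
  have Beta: "integrable unit_measure (\<lambda>u. of_real u powr (C - 1) * of_real (1 - u) powr (\<alpha> + of_nat n - 1) *
        eval_fps (fps_2F1 (\<delta> - \<beta>) (\<alpha> + C - \<delta>) C) (of_real u))"
    "(\<integral>u. of_real u powr (C - 1) * of_real (1 - u) powr (\<alpha> + of_nat n - 1) *
        eval_fps (fps_2F1 (\<delta> - \<beta>) (\<alpha> + C - \<delta>) C) (of_real u) \<partial>unit_measure) =
     Gamma C * Gamma (\<alpha> + of_nat n) * Gamma (\<beta> + of_nat n) * rGamma (\<nu> + of_nat n) * rGamma (\<delta> + of_nat n)" for n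
    using Beta_integral_2F1[OF C, of "\<alpha> + of_nat n" "\<delta> - \<beta>" "\<alpha> + C - \<delta>"] \<alpha> \<beta>
    by (simp_all add: \<nu>_def algebra_simps)
  have int_h: "integrable unit_measure (h n)" for n
  proof -
    have "integrable unit_measure (\<lambda>u. hyp_weight C \<alpha> \<beta> \<delta> u * of_real (1 - u) ^ n)"
      using Beta(1)[of n] sp by (subst Bochner_Integration.integrable_cong[OF refl weight]) auto
    then show ?thesis
      unfolding h_def by simp
  qed
  have val_h: "(\<integral>u. h n u \<partial>unit_measure) = K * (fps_nth (fps_2F1 \<alpha> \<beta> \<delta>) n * w ^ n)" for n
  proof -
    have "(\<integral>u. hyp_weight C \<alpha> \<beta> \<delta> u * of_real (1 - u) ^ n \<partial>unit_measure) =
      Gamma C * Gamma (\<alpha> + of_nat n) * Gamma (\<beta> + of_nat n) * rGamma (\<nu> + of_nat n) * rGamma (\<delta> + of_nat n)"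
      unfolding Beta(2)[symmetric] using sp weight by (intro Bochner_Integration.integral_cong) auto
    moreover have "Gamma (\<alpha> + of_nat n) = pochhammer \<alpha> n * Gamma \<alpha>"
      using not_nonpos_Int_if_Re_pos[OF \<alpha>] by (simp add: pochhammer_Gamma Gamma_eq_zero_iff)
    moreover have "Gamma (\<beta> + of_nat n) = pochhammer \<beta> n * Gamma \<beta>"
      using not_nonpos_Int_if_Re_pos[OF \<beta>] by (simp add: pochhammer_Gamma Gamma_eq_zero_iff)
    moreover have "rGamma (\<delta> + of_nat n) = rGamma \<delta> / pochhammer \<delta> n"
      using pochhammer_nonzero[OF \<delta>, of n] by (subst pochhammer_rGamma[of \<delta> n]) simp
    ultimately have "(\<integral>u. h n u \<partial>unit_measure) = Gamma C * Gamma \<alpha> * Gamma \<beta> * (pochhammer \<nu> n * rGamma (\<nu> + of_nat n)) *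
       rGamma \<delta> * (pochhammer \<alpha> n * pochhammer \<beta> n / (pochhammer \<delta> n * fact n) * w ^ n)"
      unfolding h_def by (simp add: k_def)
    also have "\<dots> = K * (fps_nth (fps_2F1 \<alpha> \<beta> \<delta>) n * w ^ n)"
      unfolding pochhammer_rGamma[symmetric] by (simp add: K_def)
    finally show ?thesis .
  qed
  have sums_h: "summable (\<lambda>n. \<integral>u. norm (h n u) \<partial>unit_measure)"
  proof (rule summable_comparison_test)
    show "summable (\<lambda>n. norm (k n) * (\<integral>u. norm (hyp_weight C \<alpha> \<beta> \<delta> u) \<partial>unit_measure))"
      using summ_k by (rule summable_mult2)
    have "(\<integral>u. norm (h n u) \<partial>unit_measure) \<le> (\<integral>u. norm (k n) * norm (hyp_weight C \<alpha> \<beta> \<delta> u) \<partial>unit_measure)" for n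
      using bound sp int_h g by (intro integral_mono) auto
    then show "\<exists>N. \<forall>n\<ge>N. norm (\<integral>u. norm (h n u) \<partial>unit_measure) \<le> norm (k n) * (\<integral>u. norm (hyp_weight C \<alpha> \<beta> \<delta> u) \<partial>unit_measure)"
      by simp
  qed
  have AE: "AE u in unit_measure. summable (\<lambda>n. norm (h n u))"
  proof (rule AE_I2)
    fix u assume "u \<in> space unit_measure"
    then show "summable (\<lambda>n. norm (h n u))"
      using bound sp by (intro summable_comparison_test[OF _ summable_mult2[OF summ_k]]) auto
  qed
  have "hyp_transform C \<alpha> \<beta> \<delta> w = (\<integral>u. (\<Sum>n. h n u) \<partial>unit_measure)"
    unfolding hyp_transform_def
  proof (rule Bochner_Integration.integral_cong)
    fix u assume "u \<in> space unit_measure"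
    then have u: "u \<in> {0<..<1}" by (rule sp)
    have "norm (w * complex_of_real (1 - u)) \<le> norm w * 1"
      unfolding norm_mult using u by (intro mult_left_mono) (auto simp del: of_real_diff)
    then have "norm (w * complex_of_real (1 - u)) < 1"
      using w by simp
    from sums_mult[OF one_minus_powr_sums(1)[OF this], of "hyp_weight C \<alpha> \<beta> \<delta> u" \<nu>]
    show "hyp_weight C \<alpha> \<beta> \<delta> u * (1 - w * of_real (1 - u)) powr (- (\<alpha> + \<beta> + C - \<delta>)) = (\<Sum>n. h n u)"
      unfolding h_def k_def \<nu>_def[symmetric] by (simp add: sums_iff power_mult_distrib mult_ac)
  qed simp
  also have "\<dots> = (\<Sum>n. K * (fps_nth (fps_2F1 \<alpha> \<beta> \<delta>) n * w ^ n))"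
    by (subst integral_suminf[OF int_h AE sums_h]) (simp add: val_h)
  also have "\<dots> = K * eval_fps (fps_2F1 \<alpha> \<beta> \<delta>) w"
    unfolding eval_fps_def
    by (intro suminf_mult summable_fps norm_less_conv_radius_2F1 \<delta> w)
  finally show ?thesis
    by (simp add: K_def \<nu>_def)
qed

subsection \<open>Analytic continuation, Pfaff and Euler transformations\<close>

lemma hyp2F1_exists_Re_pos:
  assumes a: "Re a > 0" and b: "Re b > 0" and c: "c \<notin> \<int>\<^sub>\<le>\<^sub>0"
  shows "\<exists>f. f holomorphic_on hyp_slit_plane \<and> (\<forall>z\<in>ball 0 1. f z = eval_fps (fps_2F1 a b c) z)"
proof -
  \<comment> \<open>Large enough to give Re (a + b + C - c) > 0, so that the gamma factor
    \<open>K\<close> is nonzero and can be divided out.\<close>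
  define C where "C = complex_of_real (\<bar>Re (a + b - c)\<bar> + 1)"
  define K where "K = Gamma C * Gamma a * Gamma b * rGamma (a + b + C - c) * rGamma c"
  have C: "Re C > 0"
    by (simp add: C_def)
  have "Re (a + b + C - c) > 0"
    using abs_ge_minus_self[of "Re (a + b - c)"] unfolding C_def by simp
  then have "K \<noteq> 0"
    using not_nonpos_Int_if_Re_pos a b C c
    by (simp add: K_def Gamma_eq_zero_iff rGamma_eq_zero_iff)
  have "(\<lambda>w. hyp_transform C a b c w / K) holomorphic_on hyp_slit_plane"
    using hyp_transform_holomorphic[OF C a b] \<open>K \<noteq> 0\<close> by (intro holomorphic_intros) auto
  moreover have "\<forall>z\<in>ball 0 1. hyp_transform C a b c z / K = eval_fps (fps_2F1 a b c) z"
    using hyp_transform_series[OF C a b c] \<open>K \<noteq> 0\<close> by (simp add: K_def)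
  ultimately show ?thesis by (intro exI conjI)
qed

lemma fps_deriv_2F1:
  assumes "c \<notin> \<int>\<^sub>\<le>\<^sub>0"
  shows "fps_deriv (fps_2F1 a b c) = fps_const (a * b / c) * fps_2F1 (a + 1) (b + 1) (c + 1)"
proof (rule fps_ext)
  fix n
  have "pochhammer (c + 1) n \<noteq> 0" "c \<noteq> 0" "(of_nat (Suc n) :: complex) \<noteq> 0"
    using pochhammer_nonzero[OF assms, of "Suc n"] by (auto simp: pochhammer_rec simp del: of_nat_Suc)
  note nz = this
  have fact_eq: "of_nat (fact (Suc n)) = (of_nat (Suc n) * fact n :: complex)"
    by (simp only: of_nat_fact fact_Suc of_nat_mult of_nat_id)
  have "fps_nth (fps_deriv (fps_2F1 a b c)) n =
      of_nat (Suc n) * (pochhammer a (Suc n) * pochhammer b (Suc n) / (pochhammer c (Suc n) * (of_nat (Suc n) * fact n)))"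
    by (simp add: fact_eq del: of_nat_Suc fact_Suc of_nat_fact)
  also have "\<dots> = a * b / c * (pochhammer (a + 1) n * pochhammer (b + 1) n / (pochhammer (c + 1) n * fact n))"
    using nz by (simp add: pochhammer_rec divide_simps del: of_nat_Suc)
  finally show "fps_nth (fps_deriv (fps_2F1 a b c)) n =
      fps_nth (fps_const (a * b / c) * fps_2F1 (a + 1) (b + 1) (c + 1)) n"
    by simp
qed

lemma hyp2F1_exists:
  assumes "c \<notin> \<int>\<^sub>\<le>\<^sub>0"
  shows "\<exists>f. f holomorphic_on hyp_slit_plane \<and> (\<forall>z\<in>ball 0 1. f z = eval_fps (fps_2F1 a b c) z)"
proof -
  have "\<exists>f. f holomorphic_on hyp_slit_plane \<and> (\<forall>z\<in>ball 0 1. f z = eval_fps (fps_2F1 a b c) z)"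
    if "Re a + real N > 0" "Re b + real N > 0" "c \<notin> \<int>\<^sub>\<le>\<^sub>0" for N a b c
    using that
  proof (induction N arbitrary: a b c)
    case 0
    then show ?case by (intro hyp2F1_exists_Re_pos) auto
  next
    case (Suc N)
    have c1: "c + 1 \<notin> \<int>\<^sub>\<le>\<^sub>0"
      using Suc.prems plus_one_in_nonpos_Ints_imp by blast
    obtain f where f: "f holomorphic_on hyp_slit_plane"
        "\<And>z. z \<in> ball 0 1 \<Longrightarrow> f z = eval_fps (fps_2F1 (a + 1) (b + 1) (c + 1)) z"
      using Suc.IH[of "a + 1" "b + 1" "c + 1"] Suc.prems c1 by auto
    \<comment> \<open>By induction the derivative of the series already has a continuation, namely
      \<open>d\<close>; on the starlike slit plane it has a primitive.\<close>
    define d where "d z = a * b / c * f z" for z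
    have d: "d holomorphic_on hyp_slit_plane"
      unfolding d_def by (intro holomorphic_intros f)
    have "\<exists>g. \<forall>z\<in>hyp_slit_plane. (g has_field_derivative d z) (at z)"
      by (rule holomorphic_starlike_primitive[OF holomorphic_on_imp_continuous_on[OF d]
              starlike_hyp_slit_plane open_hyp_slit_plane, of "{}"])
         (use d open_hyp_slit_plane in \<open>auto simp: holomorphic_on_open field_differentiable_def\<close>)
    then obtain g where g: "\<And>z. z \<in> hyp_slit_plane \<Longrightarrow> (g has_field_derivative d z) (at z)"
      by blast
    \<comment> \<open>On the unit disc the primitive and the series have the same derivative, so
      subtracting a constant from the primitive gives the continuation.\<close>
    have "\<exists>k. \<forall>z\<in>ball 0 1. g z - eval_fps (fps_2F1 a b c) z = k"
    proof (rule has_field_derivative_zero_constant)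
      fix z :: complex assume z: "z \<in> ball 0 1"
      then have rad: "ereal (norm z) < fps_conv_radius (fps_2F1 a b c)"
          "ereal (norm z) < fps_conv_radius (fps_2F1 (a + 1) (b + 1) (c + 1))"
        using c1 Suc.prems by (auto intro!: norm_less_conv_radius_2F1)
      have "eval_fps (fps_deriv (fps_2F1 a b c)) z = d z"
        unfolding fps_deriv_2F1[OF Suc.prems(3)] d_def f(2)[OF z]
        using rad by (subst eval_fps_mult) auto
      moreover have "(g has_field_derivative d z) (at z within ball 0 1)"
        using g z ball_subset_hyp_slit_plane by (meson has_field_derivative_at_within subsetD)
      ultimately show "((\<lambda>z. g z - eval_fps (fps_2F1 a b c) z) has_field_derivative 0) (at z within ball 0 1)"
        using DERIV_diff[OF _ has_field_derivative_eval_fps[OF rad(1)]] by fastforce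
    qed simp
    then obtain k where k: "\<And>z. z \<in> ball 0 1 \<Longrightarrow> g z - eval_fps (fps_2F1 a b c) z = k"
      by blast
    have "g holomorphic_on hyp_slit_plane"
      using g open_hyp_slit_plane by (auto simp: holomorphic_on_open)
    then have "(\<lambda>z. g z - k) holomorphic_on hyp_slit_plane"
      by (intro holomorphic_intros)
    moreover have "\<forall>z\<in>ball 0 1. g z - k = eval_fps (fps_2F1 a b c) z"
      using k by (auto simp: algebra_simps)
    ultimately show ?case by (intro exI conjI)
  qed
  moreover obtain k l :: nat where "Re a + real k > 0" "Re b + real l > 0"
    using ex_Re_add_nat_pos by blast
  moreover have "Re a + real (max k l) \<ge> Re a + real k" "Re b + real (max k l) \<ge> Re b + real l"
    by simp_all
  ultimately show ?thesis
    using assms by (meson less_le_trans)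
qed

text \<open>Existence makes the choice operator in \<open>hyp2F1\<close> return a function with both
  required properties.\<close>

lemma
  assumes "c \<notin> \<int>\<^sub>\<le>\<^sub>0"
  shows hyp2F1_holomorphic: "hyp2F1 a b c holomorphic_on hyp_slit_plane"
    and hyp2F1_eq_eval_fps: "norm z < 1 \<Longrightarrow> hyp2F1 a b c z = eval_fps (fps_2F1 a b c) z"
  using someI_ex[OF hyp2F1_exists[OF assms, of a b]] by (auto simp: hyp2F1_def)

lemma hyp2F1_has_fps_expansion:
  assumes "c \<notin> \<int>\<^sub>\<le>\<^sub>0"
  shows "hyp2F1 a b c has_fps_expansion fps_2F1 a b c"
  unfolding has_fps_expansion_def
proof
  show "0 < fps_conv_radius (fps_2F1 a b c)"
    using norm_less_conv_radius_2F1[OF assms, of 0 a b] by (simp add: zero_ereal_def)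
  have "eventually (\<lambda>z::complex. z \<in> ball 0 1) (nhds 0)"
    by (intro eventually_nhds_in_open) auto
  then show "eventually (\<lambda>z. eval_fps (fps_2F1 a b c) z = hyp2F1 a b c z) (nhds 0)"
    by eventually_elim (use hyp2F1_eq_eval_fps[OF assms] in auto)
qed

text \<open>Both sides are holomorphic on the slit plane and agree on the unit disc by
  \<open>hyp_transform_series\<close>.\<close>

lemma hyp_transform_eq:
  assumes "Re C > 0" "Re \<alpha> > 0" "Re \<beta> > 0" and \<delta>: "\<delta> \<notin> \<int>\<^sub>\<le>\<^sub>0" and w: "w \<in> hyp_slit_plane"
  shows "hyp_transform C \<alpha> \<beta> \<delta> w =
    Gamma C * Gamma \<alpha> * Gamma \<beta> * rGamma (\<alpha> + \<beta> + C - \<delta>) * rGamma \<delta> * hyp2F1 \<alpha> \<beta> \<delta> w"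
proof (rule hyp_slit_plane_eqI[OF _ _ _ w])
  show "hyp_transform C \<alpha> \<beta> \<delta> holomorphic_on hyp_slit_plane"
    using assms by (intro hyp_transform_holomorphic)
  show "(\<lambda>w. Gamma C * Gamma \<alpha> * Gamma \<beta> * rGamma (\<alpha> + \<beta> + C - \<delta>) * rGamma \<delta> * hyp2F1 \<alpha> \<beta> \<delta> w) holomorphic_on hyp_slit_plane"
    by (intro holomorphic_on_mult holomorphic_on_const hyp2F1_holomorphic \<delta>)
  have "eventually (\<lambda>z::complex. z \<in> ball 0 1) (nhds 0)"
    by (intro eventually_nhds_in_open) auto
  then show "eventually (\<lambda>w. hyp_transform C \<alpha> \<beta> \<delta> w =
    Gamma C * Gamma \<alpha> * Gamma \<beta> * rGamma (\<alpha> + \<beta> + C - \<delta>) * rGamma \<delta> * hyp2F1 \<alpha> \<beta> \<delta> w) (nhds 0)"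
    by eventually_elim (use assms in \<open>simp add: hyp_transform_series hyp2F1_eq_eval_fps\<close>)
qed

text \<open>The two series coincide, so both sides are choices by one and the same
  predicate.\<close>

lemma hyp2F1_commute: "hyp2F1 a b c = hyp2F1 b a c"
proof -
  have "fps_2F1 a b c = fps_2F1 b a c"
    by (simp add: fps_eq_iff mult.commute)
  then show ?thesis
    by (simp only: hyp2F1_def)
qed

section \<open>Pfaff's transformation for formal power series\<close>

text \<open>The binomial series of (1 - z)^(-a), with exponent -a so that the coefficients carry no
  signs.\<close>

definition fps_one_minus_powr :: "complex \<Rightarrow> complex fps" where
  "fps_one_minus_powr a = Abs_fps (\<lambda>n. pochhammer a n / fact n)"

lemma fps_one_minus_powr_expansion:
  "(\<lambda>z. (1 - z) powr (- a)) has_fps_expansion fps_one_minus_powr a"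
proof (rule has_fps_expansionI)
  have "eventually (\<lambda>z::complex. z \<in> ball 0 1) (nhds 0)"
    by (intro eventually_nhds_in_open) auto
  then show "eventually (\<lambda>z. (\<lambda>n. fps_nth (fps_one_minus_powr a) n * z ^ n) sums ((1 - z) powr (- a))) (nhds 0)"
    by eventually_elim (use one_minus_powr_sums(1)[of _ a] in \<open>auto simp: fps_one_minus_powr_def\<close>)
qed

text \<open>The law of exponents for functions, carried over to series by uniqueness of
  expansions.\<close>

lemma fps_one_minus_powr_add:
  "fps_one_minus_powr a * fps_one_minus_powr b = fps_one_minus_powr (a + b)"
proof (rule fps_expansion_unique_complex)
  show "(\<lambda>z. (1 - z) powr (- a) * (1 - z) powr (- b)) has_fps_expansion fps_one_minus_powr a * fps_one_minus_powr b"
    by (intro fps_expansion_intros fps_one_minus_powr_expansion)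
  show "(\<lambda>z. (1 - z) powr (- a) * (1 - z) powr (- b)) has_fps_expansion fps_one_minus_powr (a + b)"
    using fps_one_minus_powr_expansion[of "a + b"] unfolding powr_add[symmetric] by simp
qed

lemma fps_one_minus_powr_power: "fps_one_minus_powr 1 ^ i = fps_one_minus_powr (of_nat i)"
proof (induction i)
  case 0
  show ?case
    by (simp add: fps_eq_iff fps_one_minus_powr_def pochhammer_0_left)
next
  case (Suc i)
  then show ?case
    by (simp add: fps_one_minus_powr_add)
qed

text \<open>Introduces the upper parameter -n, which turns the sum in \<open>fps_2F1_pfaff\<close>
  into a terminating hypergeometric sum.\<close>

lemma pochhammer_minus_of_nat:
  assumes "i \<le> n"
  shows "pochhammer (- of_nat n :: complex) i / fact n = (-1) ^ i / fact (n - i)"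
proof -
  have "fact n / (fact i * fact (n - i)) = (of_nat n :: complex) gchoose i"
    using assms by (simp add: binomial_fact flip: binomial_gbinomial)
  also have "\<dots> = (-1) ^ i * pochhammer (- of_nat n) i / fact i"
    by (rule gbinomial_pochhammer)
  finally have "fact n / fact (n - i) = (-1) ^ i * pochhammer (- of_nat n :: complex) i"
    by (simp add: field_simps)
  then have "(-1) ^ i * (fact n / fact (n - i)) = ((-1) ^ i * (-1) ^ i) * pochhammer (- of_nat n :: complex) i"
    by (simp only: mult.assoc)
  also have "(-1 :: complex) ^ i * (-1) ^ i = 1"
    by (simp flip: power_mult_distrib)
  finally show ?thesis
    by (simp add: field_simps)
qed

text \<open>The inner series is that of z/(z-1). The n-th coefficient of the left-hand side is
  (a)_n/n! times the terminating sum F(-n,c-b;c;1), which equals (b)_n/(c)_n by the Chu-Vandermonde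
  identity.\<close>

lemma fps_2F1_pfaff:
  assumes c: "c \<notin> \<int>\<^sub>\<le>\<^sub>0"
  shows "fps_one_minus_powr a * (fps_2F1 a (c - b) c oo (- fps_X * fps_one_minus_powr 1)) = fps_2F1 a b c"
proof (rule fps_ext)
  fix n
  define G where "G = - fps_X * fps_one_minus_powr 1"
  define F where "F = fps_2F1 a (c - b) c"
  have G_pow: "G ^ i = fps_X ^ i * (fps_const ((-1) ^ i) * fps_one_minus_powr (of_nat i))" for i
  proof -
    have neg: "fps_const (- 1 :: complex) = - 1"
      by (metis fps_const_neg fps_const_1_eq_1)
    have "G = fps_X * (fps_const (- 1) * fps_one_minus_powr 1)"
      unfolding G_def neg by simp
    then show ?thesis
      by (simp add: power_mult_distrib fps_one_minus_powr_power)
  qed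
  have AG: "fps_nth (fps_one_minus_powr a * G ^ i) n = (-1) ^ i * pochhammer (a + of_nat i) (n - i) / fact (n - i)"
    if "i \<le> n" for i
  proof -
    have "fps_one_minus_powr a * G ^ i = fps_X ^ i * (fps_const ((-1) ^ i) * fps_one_minus_powr (a + of_nat i))"
      by (simp add: G_pow mult_ac flip: fps_one_minus_powr_add)
    then show ?thesis
      using that by (simp add: fps_X_power_mult_nth fps_one_minus_powr_def)
  qed
  have G_low: "fps_nth (G ^ i) j = 0" if "j < i" for i j
    using that by (simp add: G_pow fps_X_power_mult_nth)
  \<comment> \<open>Since \<open>G ^ i\<close> starts with \<open>fps_X ^ i\<close>, the inner sums
    may all be extended to the range 0..n, after which the summations can be swapped.\<close>
  have "fps_nth (fps_one_minus_powr a * (F oo G)) n =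
      (\<Sum>j=0..n. fps_nth (fps_one_minus_powr a) (n - j) * (\<Sum>i=0..n. fps_nth F i * fps_nth (G ^ i) j))"
  proof -
    have "(\<Sum>i=0..j. fps_nth F i * fps_nth (G ^ i) j) = (\<Sum>i=0..n. fps_nth F i * fps_nth (G ^ i) j)" if "j \<le> n" for j
      using that by (intro sum.mono_neutral_left) (auto simp: G_low)
    then show ?thesis
      unfolding mult.commute[of "fps_one_minus_powr a"] fps_mult_nth fps_compose_nth
      by (intro sum.cong) (auto simp: mult.commute)
  qed
  also have "\<dots> = (\<Sum>i=0..n. fps_nth F i * (\<Sum>j=0..n. fps_nth (G ^ i) j * fps_nth (fps_one_minus_powr a) (n - j)))"
    unfolding sum_distrib_left by (subst sum.swap) (simp add: mult_ac)
  also have "\<dots> = (\<Sum>i=0..n. fps_nth F i * fps_nth (fps_one_minus_powr a * G ^ i) n)"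
    unfolding mult.commute[of "fps_one_minus_powr a"] fps_mult_nth ..
  also have "\<dots> = (\<Sum>i=0..n. pochhammer a n / fact n *
       (pochhammer (c - b) i * pochhammer (- of_nat n) i / (of_nat (fact i) * pochhammer c i)))"
  proof (rule sum.cong[OF refl])
    fix i assume "i \<in> {0..n}"
    then have i: "i \<le> n" by simp
    have "fps_nth F i * fps_nth (fps_one_minus_powr a * G ^ i) n =
        (pochhammer a i * pochhammer (a + of_nat i) (n - i)) * pochhammer (c - b) i / (fact i * pochhammer c i) *
        ((-1) ^ i / fact (n - i))"
      by (simp add: AG[OF i] F_def mult_ac)
    also have "\<dots> = pochhammer a n / fact n *
       (pochhammer (c - b) i * pochhammer (- of_nat n) i / (of_nat (fact i) * pochhammer c i))"
      unfolding pochhammer_product[OF i, symmetric] pochhammer_minus_of_nat[OF i, symmetric]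
      by (simp add: mult_ac)
    finally show "fps_nth F i * fps_nth (fps_one_minus_powr a * G ^ i) n = \<dots>" .
  qed
  also have "\<dots> = pochhammer a n / fact n * (pochhammer (c - (c - b)) n / pochhammer c n)"
    unfolding sum_distrib_left[symmetric]
    by (subst Vandermonde_pochhammer) (use c in auto)
  also have "\<dots> = fps_nth (fps_2F1 a b c) n"
    by simp
  finally show "fps_nth (fps_one_minus_powr a * (fps_2F1 a (c - b) c oo (- fps_X * fps_one_minus_powr 1))) n =
      fps_nth (fps_2F1 a b c) n"
    by (simp only: F_def G_def)
qed

section \<open>Pfaff's and Euler's transformations on the slit plane\<close>

lemma one_minus_hyp_slit_plane: "z \<in> hyp_slit_plane \<Longrightarrow> 1 - z \<notin> \<real>\<^sub>\<le>\<^sub>0"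
  using hyp_slit_plane_kernel[of z 1] by simp

text \<open>The map is an involution that sends real x > 1 to x/(x-1) > 1 and never takes the value
  1, so no point off the cut can land on it.\<close>

lemma pfaff_hyp_slit_plane:
  assumes z: "z \<in> hyp_slit_plane"
  shows "z / (z - 1) \<in> hyp_slit_plane"
proof -
  have "z \<noteq> 1"
    using z by (auto simp: hyp_slit_plane_def)
  have False if x: "x \<ge> 1" "z / (z - 1) = of_real x" for x
  proof -
    have eq: "z * of_real (x - 1) = of_real x"
      using x(2) \<open>z \<noteq> 1\<close> by (simp add: field_simps)
    with x(1) have "x \<noteq> 1"
      by auto
    with eq have "z = of_real (x / (x - 1))"
      by (simp add: field_simps)
    moreover have "x / (x - 1) \<ge> 1"
      using x(1) \<open>x \<noteq> 1\<close> by (simp add: field_simps)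
    ultimately show False
      using z unfolding hyp_slit_plane_def by blast
  qed
  then show ?thesis
    unfolding hyp_slit_plane_def by auto
qed

text \<open>By \<open>fps_2F1_pfaff\<close> both sides have the same expansion at 0; the identity
  theorem does the rest.\<close>

theorem hyp2F1_pfaff:
  assumes c: "c \<notin> \<int>\<^sub>\<le>\<^sub>0" and z: "z \<in> hyp_slit_plane"
  shows "hyp2F1 a b c z = (1 - z) powr (- a) * hyp2F1 a (c - b) c (z / (z - 1))"
proof (rule hyp_slit_plane_eqI[OF _ _ _ z])
  show "hyp2F1 a b c holomorphic_on hyp_slit_plane"
    by (rule hyp2F1_holomorphic[OF c])
  have "(hyp2F1 a (c - b) c \<circ> (\<lambda>z. z / (z - 1))) holomorphic_on hyp_slit_plane"
  proof (rule holomorphic_on_compose_gen[OF _ hyp2F1_holomorphic[OF c]])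
    show "(\<lambda>z. z / (z - 1)) holomorphic_on hyp_slit_plane"
      by (intro holomorphic_intros) (auto simp: hyp_slit_plane_def)
    show "(\<lambda>z. z / (z - 1)) ` hyp_slit_plane \<subseteq> hyp_slit_plane"
      using pfaff_hyp_slit_plane by auto
  qed
  then show "(\<lambda>z. (1 - z) powr (- a) * hyp2F1 a (c - b) c (z / (z - 1))) holomorphic_on hyp_slit_plane"
    unfolding o_def by (intro holomorphic_intros) (use one_minus_hyp_slit_plane in auto)
  have "(\<lambda>z. z / (z - 1)) has_fps_expansion (- fps_X * fps_one_minus_powr 1)"
  proof -
    have "(\<lambda>z. - z * (1 - z) powr (- 1)) has_fps_expansion (- fps_X * fps_one_minus_powr 1)"
      by (intro fps_expansion_intros fps_one_minus_powr_expansion)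
    also have "(\<lambda>z::complex. - z * (1 - z) powr (- 1)) = (\<lambda>z. z / (z - 1))"
    proof
      fix z :: complex
      have "(1 - z) powr (- 1) = inverse (1 - z)"
        using powr_minus[of "1 - z" 1] by (cases "z = 1") auto
      then show "- z * (1 - z) powr (- 1) = z / (z - 1)"
        using inverse_minus_eq[of "1 - z"] by (simp add: divide_inverse)
    qed
    finally show ?thesis .
  qed
  then have "(hyp2F1 a (c - b) c \<circ> (\<lambda>z. z / (z - 1))) has_fps_expansion
     (fps_2F1 a (c - b) c oo (- fps_X * fps_one_minus_powr 1))"
    by (intro has_fps_expansion_compose hyp2F1_has_fps_expansion c) auto
  then have "(\<lambda>z. (1 - z) powr (- a) * (hyp2F1 a (c - b) c \<circ> (\<lambda>z. z / (z - 1))) z) has_fps_expansion fps_2F1 a b c"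
    unfolding fps_2F1_pfaff[OF c, of a b, symmetric]
    by (intro has_fps_expansion_mult fps_one_minus_powr_expansion)
  then have "eventually (\<lambda>z. eval_fps (fps_2F1 a b c) z = (1 - z) powr (- a) * hyp2F1 a (c - b) c (z / (z - 1))) (nhds 0)"
    by (simp add: has_fps_expansion_def o_def)
  moreover have "eventually (\<lambda>z. eval_fps (fps_2F1 a b c) z = hyp2F1 a b c z) (nhds 0)"
    using hyp2F1_has_fps_expansion[OF c] by (simp add: has_fps_expansion_def)
  ultimately show "eventually (\<lambda>z. hyp2F1 a b c z = (1 - z) powr (- a) * hyp2F1 a (c - b) c (z / (z - 1))) (nhds 0)"
    by eventually_elim simp
qed

text \<open>Pfaff's transformation twice, with the upper parameters exchanged in between; the
  substitution z/(z-1) undoes itself.\<close>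

theorem hyp2F1_euler:
  assumes c: "c \<notin> \<int>\<^sub>\<le>\<^sub>0" and z: "z \<in> hyp_slit_plane"
  shows "hyp2F1 a b c z = (1 - z) powr (c - a - b) * hyp2F1 (c - a) (c - b) c z"
proof -
  define w where "w = z / (z - 1)"
  have "z \<noteq> 1"
    using z by (auto simp: hyp_slit_plane_def)
  then have w: "w / (w - 1) = z" "1 - w = inverse (1 - z)"
    by (auto simp: w_def field_simps)
  \<comment> \<open>Valid for the principal branch because 1 - z avoids the nonpositive real
    axis.\<close>
  have "inverse (1 - z) powr (- (c - b)) = (1 - z) powr (c - b)"
    using \<open>z \<noteq> 1\<close> Ln_inverse[OF one_minus_hyp_slit_plane[OF z]] by (simp add: powr_def algebra_simps)
  then have "hyp2F1 (c - b) a c w = (1 - z) powr (c - b) * hyp2F1 (c - b) (c - a) c z"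
    using hyp2F1_pfaff[OF c pfaff_hyp_slit_plane[OF z], of "c - b" a]
    unfolding w_def[symmetric] w by simp
  then have "hyp2F1 a b c z = ((1 - z) powr (- a) * (1 - z) powr (c - b)) * hyp2F1 (c - a) (c - b) c z"
    unfolding hyp2F1_pfaff[OF c z, of a b] w_def[symmetric] hyp2F1_commute[of a "c - b"] hyp2F1_commute[of "c - a" "c - b"]
    by simp
  then show ?thesis
    unfolding powr_add[symmetric] by (simp add: algebra_simps)
qed

subsection \<open>The Stieltjes-type transform\<close>

text \<open>The substitution t = u/(1-u), with derivative 1/(1-u)^2 and end points 0 and
  \<infinity>.\<close>

lemma integral_substitution_unit_to_pos:
  fixes f :: "real \<Rightarrow> complex"
  assumes cont: "continuous_on {0<..} f"
    and int: "integrable unit_measure (\<lambda>u. (1 / (1 - u)\<^sup>2) *\<^sub>R f (u / (1 - u)))"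
  shows "set_integrable lborel {0<..} f"
    and "set_lebesgue_integral lborel {0<..} f = (\<integral>u. (1 / (1 - u)\<^sup>2) *\<^sub>R f (u / (1 - u)) \<partial>unit_measure)"
proof -
  define g where "g u = u / (1 - u)" for u :: real
  define g' where "g' u = 1 / (1 - u)\<^sup>2" for u :: real
  have ei: "einterval 0 1 = {0<..<1}" "einterval 0 \<infinity> = {0<..}"
    by (auto simp: einterval_def zero_ereal_def one_ereal_def)
  have deriv: "DERIV g u :> g' u" if "0 < ereal u" "ereal u < 1" for u
    unfolding g_def g'_def using that
    by (auto intro!: derivative_eq_intros simp: one_ereal_def power2_eq_square field_simps)
  have gpos: "g u > 0" if "0 < ereal u" "ereal u < 1" for u
    using that by (auto simp: g_def one_ereal_def)
  have contf: "isCont f (g u)" if "0 < ereal u" "ereal u < 1" for u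
    using cont gpos[OF that] by (simp add: continuous_on_eq_continuous_at)
  have contg': "isCont g' u" if "0 < ereal u" "ereal u < 1" for u
    unfolding g'_def using that by (intro continuous_intros) (auto simp: one_ereal_def)
  have g'_nonneg: "0 \<le> g' u" for u
    by (simp add: g'_def)
  have A: "((ereal \<circ> g \<circ> real_of_ereal) \<longlongrightarrow> 0) (at_right 0)"
    unfolding zero_ereal_def ereal_tendsto_simps g_def by (auto intro!: tendsto_eq_intros)
  have B: "((ereal \<circ> g \<circ> real_of_ereal) \<longlongrightarrow> \<infinity>) (at_left 1)"
    unfolding one_ereal_def ereal_tendsto_simps g_def by real_asymp
  have set_int: "set_integrable lborel (einterval 0 1) (\<lambda>u. g' u *\<^sub>R f (g u))"
    using int unfolding ei g_def g'_def by (simp add: integrable_restrict_space set_integrable_def)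
  have "set_integrable lborel (einterval 0 1) (\<lambda>u. norm (f (g u)) * g' u)"
    using set_integrable_norm[OF set_int] g'_nonneg by (simp add: mult.commute)
  note int_norm = this
  \<comment> \<open>The substitution rule for complex integrands presupposes integrability on the
    half-line. The rule for nonnegative integrands, applied to the norm, supplies it.\<close>
  have "set_integrable lborel (einterval 0 \<infinity>) (\<lambda>t. norm (f t))"
  proof (rule interval_integral_substitution_nonneg(1)[OF _ _ _ _ _ _ A B])
    show "isCont (\<lambda>t. norm (f t)) (g u)" if "0 < ereal u" "ereal u < 1" for u
      using contf[OF that] by (rule continuous_norm)
    show "set_integrable lborel (einterval 0 1) (\<lambda>u. norm (f (g u)) * g' u)"
      by (rule int_norm)
  qed (auto intro: deriv contg' g'_nonneg)
  then have norm_int: "integrable lborel (\<lambda>t. indicator {0<..} t *\<^sub>R norm (f t))"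
    unfolding ei set_integrable_def .
  have "(\<lambda>t. indicator {0<..} t *\<^sub>R f t) \<in> borel_measurable lborel"
    using borel_measurable_continuous_on_indicator[OF _ cont] by simp
  then have f_int: "set_integrable lborel {0<..} f"
    unfolding set_integrable_def
    by (rule Bochner_Integration.integrable_bound[OF norm_int]) (auto intro!: AE_I2 simp: indicator_def)
  then show "set_integrable lborel {0<..} f" .
  have "(LBINT t=0..\<infinity>. f t) = (LBINT u=0..1. g' u *\<^sub>R f (g u))"
  proof (rule interval_integral_substitution_integrable[OF _ _ _ _ _ A B])
    show "set_integrable lborel (einterval 0 1) (\<lambda>u. g' u *\<^sub>R f (g u))"
      by (rule set_int)
    show "set_integrable lborel (einterval 0 \<infinity>) f"
      unfolding ei by (rule f_int)
  qed (auto intro: deriv contf contg' g'_nonneg)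
  then show "set_lebesgue_integral lborel {0<..} f = (\<integral>u. (1 / (1 - u)\<^sup>2) *\<^sub>R f (u / (1 - u)) \<partial>unit_measure)"
    by (simp add: interval_lebesgue_integral_def ei g_def g'_def integral_restrict_space set_lebesgue_integral_def)
qed

lemma powr_of_real_divide:
  fixes p :: complex
  assumes "x > 0" "y > 0"
  shows "of_real (x / y) powr p = of_real x powr p * of_real y powr (- p)"
proof -
  have *: "complex_of_real r powr q = exp (q * of_real (ln r))" if "r > 0" for r q
    using that by (simp add: powr_def Ln_of_real)
  show ?thesis
    using assms unfolding *[OF assms(1)] *[OF assms(2)] *[OF divide_pos_pos[OF assms]] exp_add[symmetric]
    by (simp add: ln_div algebra_simps)
qed

lemma of_real_less_1_in_hyp_slit_plane: "x < 1 \<Longrightarrow> complex_of_real x \<in> hyp_slit_plane"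
  by (auto simp: hyp_slit_plane_def)

text \<open>The common source of both identities, parametrised by the function that comes out so
  that \<open>hyp_transform_eq\<close> at w = 1 - s applies directly.\<close>

theorem hyp2F1_Stieltjes_transform:
  fixes s :: real
  assumes C: "Re C > 0" and \<alpha>: "Re \<alpha> > 0" and \<beta>: "Re \<beta> > 0" and \<delta>: "\<delta> \<notin> \<int>\<^sub>\<le>\<^sub>0" and s: "s > 0"
  defines "\<nu> \<equiv> \<alpha> + \<beta> + C - \<delta>"
  defines "f \<equiv> (\<lambda>t. of_real t powr (C - 1) * hyp2F1 (\<delta> - \<beta>) (\<delta> - \<alpha>) C (of_real (- t)) * of_real (t + s) powr (- \<nu>))"
  shows "set_integrable lborel {0<..} f"
    and "set_lebesgue_integral lborel {0<..} f =
      Gamma C * Gamma \<alpha> * Gamma \<beta> * rGamma \<nu> * rGamma \<delta> * hyp2F1 \<alpha> \<beta> \<delta> (of_real (1 - s))"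
proof -
  have Cn: "C \<notin> \<int>\<^sub>\<le>\<^sub>0"
    using C by (rule not_nonpos_Int_if_Re_pos)
  have w: "complex_of_real (1 - s) \<in> hyp_slit_plane"
    using s by (intro of_real_less_1_in_hyp_slit_plane) simp
  have cont: "continuous_on {0<..} f"
  proof -
    have "continuous_on {0<..} (\<lambda>t::real. hyp2F1 (\<delta> - \<beta>) (\<delta> - \<alpha>) C (of_real (- t)))"
      by (rule continuous_on_compose2[OF holomorphic_on_imp_continuous_on[OF hyp2F1_holomorphic[OF Cn]]])
         (auto intro!: continuous_intros of_real_less_1_in_hyp_slit_plane simp del: of_real_minus)
    then show ?thesis
      unfolding f_def using s
      by (intro continuous_on_mult continuous_on_powr_const continuous_intros)
         (auto simp: complex_nonpos_Reals_iff simp del: of_real_add)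
  qed
  have eq: "(1 / (1 - u)\<^sup>2) *\<^sub>R f (u / (1 - u)) =
      hyp_weight C \<alpha> \<beta> \<delta> u * (1 - of_real (1 - s) * of_real (1 - u)) powr (- \<nu>)"
    if u: "u \<in> {0<..<1}" for u
  proof -
    define v where "v = 1 - u"
    have v: "v > 0" "u > 0" "u < 1"
      using u by (auto simp: v_def)
    define X where "X = complex_of_real v"
    have z: "complex_of_real (- (u / v)) \<in> hyp_slit_plane"
      using v by (intro of_real_less_1_in_hyp_slit_plane) (auto intro: less_trans[of _ 0])
    have v1: "1 + u / v = 1 / v"
      using v by (simp add: v_def field_simps)
    then have "1 - complex_of_real (- (u / v)) = of_real (1 / v)"
      by (metis diff_minus_eq_add of_real_1 of_real_add of_real_minus)
    note arg2 = this
    then have "complex_of_real (- (u / v)) - 1 = of_real (- (1 / v))"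
      by (metis minus_diff_eq of_real_minus)
    \<comment> \<open>With t = u/v, Pfaff's transformation moves the argument -t to u in (0,1),
      where the power series in \<open>hyp_weight\<close> represents the function.\<close>
    then have arg1: "complex_of_real (- (u / v)) / (complex_of_real (- (u / v)) - 1) = of_real u"
      using v(1) by simp
    have p1: "complex_of_real (1 / v) powr q = X powr (- q)" for q
      using powr_of_real_divide[of 1 v q] v by (simp add: X_def)
    have p2: "complex_of_real (u / v) powr q = of_real u powr q * X powr (- q)" for q
      using powr_of_real_divide[of u v q] v by (simp add: X_def)
    \<comment> \<open>The numerator of t + s over the denominator v; it equals 1 - (1-s) v, the base
      of the kernel at w = 1 - s.\<close>
    define r where "r = u + s * v"
    have r: "r > 0" "u / v + s = r / v"
      using v s by (auto simp: r_def field_simps add_pos_pos)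
    have r_eq: "1 - complex_of_real (1 - s) * of_real v = of_real r"
      by (simp add: r_def v_def algebra_simps)
    have p3: "complex_of_real (u / v + s) powr q = of_real r powr q * X powr (- q)" for q
      unfolding r(2) using powr_of_real_divide[of r v q] v r by (simp add: X_def)
    have F: "hyp2F1 (\<delta> - \<beta>) (\<delta> - \<alpha>) C (of_real (- (u / v))) =
      X powr (\<delta> - \<beta>) * eval_fps (fps_2F1 (\<delta> - \<beta>) (\<alpha> + C - \<delta>) C) (of_real u)"
      unfolding hyp2F1_pfaff[OF Cn z] arg1 arg2 p1
      using hyp2F1_eq_eval_fps[OF Cn, of "of_real u" "\<delta> - \<beta>" "C - (\<delta> - \<alpha>)"] v by (simp add: algebra_simps)
    have p4: "complex_of_real (1 / v\<^sup>2) = X powr (- 2)"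
    proof -
      have "X powr 2 = X ^ 2"
        using powr_complexpow[of X 2] v by (simp add: X_def)
      then show ?thesis
        by (simp add: powr_minus X_def field_simps)
    qed
    have "(1 / v\<^sup>2) *\<^sub>R f (u / v) =
       of_real u powr (C - 1) * (X powr (- 2) * X powr (- (C - 1)) * X powr (\<delta> - \<beta>) * X powr \<nu>) *
       eval_fps (fps_2F1 (\<delta> - \<beta>) (\<alpha> + C - \<delta>) C) (of_real u) * of_real r powr (- \<nu>)"
      unfolding f_def F p2 p3 scaleR_conv_of_real p4 by (simp add: mult_ac)
    \<comment> \<open>The powers of v = 1 - u come from the Jacobian, from the power of t, from
      Pfaff's prefactor and from the power of t + s; their exponents add up to \<alpha> - 1.\<close>
    also have "X powr (- 2) * X powr (- (C - 1)) * X powr (\<delta> - \<beta>) * X powr \<nu> = X powr (\<alpha> - 1)"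
      unfolding powr_add[symmetric] by (rule arg_cong[where f = "\<lambda>q. X powr q"]) (simp add: \<nu>_def algebra_simps)
    finally show ?thesis
      unfolding r_eq[symmetric] by (simp only: hyp_weight_def X_def v_def)
  qed
  have sp: "u \<in> space unit_measure \<Longrightarrow> u \<in> {0<..<1}" for u
    by (simp add: space_restrict_space)
  have int: "integrable unit_measure (\<lambda>u. (1 / (1 - u)\<^sup>2) *\<^sub>R f (u / (1 - u)))"
    using hyp_transform_integrable[OF C \<alpha> \<beta> w, of \<delta> "- \<nu>"] sp
    by (subst Bochner_Integration.integrable_cong[OF refl eq]) auto
  show "set_integrable lborel {0<..} f"
    by (rule integral_substitution_unit_to_pos(1)[OF cont int])
  have "set_lebesgue_integral lborel {0<..} f = hyp_transform C \<alpha> \<beta> \<delta> (of_real (1 - s))"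
    unfolding integral_substitution_unit_to_pos(2)[OF cont int] hyp_transform_def \<nu>_def[symmetric]
    using sp eq by (intro Bochner_Integration.integral_cong) auto
  then show "set_lebesgue_integral lborel {0<..} f =
      Gamma C * Gamma \<alpha> * Gamma \<beta> * rGamma \<nu> * rGamma \<delta> * hyp2F1 \<alpha> \<beta> \<delta> (of_real (1 - s))"
    unfolding hyp_transform_eq[OF C \<alpha> \<beta> \<delta> w] \<nu>_def .
qed

section \<open>Moving the half-lines to the positive axis, and the two identities\<close>

lemma set_integral_reflect_pos:
  fixes f :: "real \<Rightarrow> 'a :: {banach, second_countable_topology}"
  assumes "set_integrable lborel {0<..} (\<lambda>t. f (- t))"
  shows "set_integrable lborel {..<0} f"
    and "set_lebesgue_integral lborel {..<0} f = set_lebesgue_integral lborel {0<..} (\<lambda>t. f (- t))"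
proof -
  have eq: "indicator {..<0} (0 + (-1) * t) *\<^sub>R f (0 + (-1) * t) = indicator {0<..} t *\<^sub>R f (- t)" for t :: real
    by (auto simp: indicator_def)
  show "set_integrable lborel {..<0} f"
    using assms lborel_integrable_real_affine_iff[of "-1" "\<lambda>t. indicator {..<0} t *\<^sub>R f t" 0]
    unfolding eq set_integrable_def by simp
  show "set_lebesgue_integral lborel {..<0} f = set_lebesgue_integral lborel {0<..} (\<lambda>t. f (- t))"
    using lborel_integral_real_affine[of "-1" "\<lambda>t. indicator {..<0} t *\<^sub>R f t" 0]
    unfolding eq set_lebesgue_integral_def by simp
qed

lemma set_integral_shift_pos:
  fixes f :: "real \<Rightarrow> 'a :: {banach, second_countable_topology}"
  assumes "set_integrable lborel {0<..} (\<lambda>t. f (b + t))"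
  shows "set_integrable lborel {b<..} f"
    and "set_lebesgue_integral lborel {b<..} f = set_lebesgue_integral lborel {0<..} (\<lambda>t. f (b + t))"
proof -
  have eq: "indicator {b<..} (b + 1 * t) *\<^sub>R f (b + 1 * t) = indicator {0<..} t *\<^sub>R f (b + t)" for t :: real
    by (auto simp: indicator_def)
  show "set_integrable lborel {b<..} f"
    using assms lborel_integrable_real_affine_iff[of 1 "\<lambda>t. indicator {b<..} t *\<^sub>R f t" b]
    unfolding eq set_integrable_def by simp
  show "set_lebesgue_integral lborel {b<..} f = set_lebesgue_integral lborel {0<..} (\<lambda>t. f (b + t))"
    using lborel_integral_real_affine[of 1 "\<lambda>t. indicator {b<..} t *\<^sub>R f t" b]
    unfolding eq set_lebesgue_integral_def by simp
qed

text \<open>The Stieltjes transform with y = -t, s = x, lower parameter C = 2-c, \<alpha> =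
  c-a-\<mu>, \<beta> = c-b-\<mu> and \<delta> = c-a-b-\<mu>+1, so that \<nu> = 1-\<mu>.\<close>

lemma fractional_integral_w2:
  fixes a b c \<mu> :: complex and x :: real
  assumes "Re (c - a - \<mu>) > 0" "Re (c - b - \<mu>) > 0" "Re (2 - c) > 0"
    and \<delta>: "(c - \<mu>) - a - b + 1 \<notin> \<int>\<^sub>\<le>\<^sub>0" and x: "x \<in> {0<..<1} \<union> {1<..}"
  defines "h \<equiv> (\<lambda>y::real. complex_of_real (1 - y) powr (a + b - c) * w2 y a b c *
                complex_of_real (x - y) powr (\<mu> - 1))"
  shows "set_integrable lborel {..<0} h"
    and "set_lebesgue_integral lborel {..<0} h =
        Gamma (c - a - \<mu>) * Gamma (c - b - \<mu>) * Gamma (2 - c) *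
          rGamma (c - a - b - \<mu> + 1) * rGamma (1 - \<mu>) *
          complex_of_real \<bar>1 - x\<bar> powr (a + b - c + \<mu>) * w6 x a b (c - \<mu>)"
proof -
  let ?f = "\<lambda>t. of_real t powr (2 - c - 1) * hyp2F1 (1 - a) (1 - b) (2 - c) (of_real (- t)) *
      of_real (t + x) powr (- (1 - \<mu>))"
  have "x > 0"
    using x by auto
  have \<delta>': "c - a - b - \<mu> + 1 \<notin> \<int>\<^sub>\<le>\<^sub>0"
    using \<delta> by (simp add: algebra_simps)
  have ident: "c - a - b - \<mu> + 1 - (c - b - \<mu>) = 1 - a" "c - a - b - \<mu> + 1 - (c - a - \<mu>) = 1 - b"
    "c - a - \<mu> + (c - b - \<mu>) + (2 - c) - (c - a - b - \<mu> + 1) = 1 - \<mu>"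
    by (simp_all add: algebra_simps)
  note S = hyp2F1_Stieltjes_transform[OF assms(3,1,2) \<delta>' \<open>x > 0\<close>, unfolded ident]
  have eq: "h (- t) = ?f t" if "t \<in> {0<..}" for t
  proof -
    have t: "t > 0"
      using that by simp
    have z: "complex_of_real (- t) \<in> hyp_slit_plane"
      using t by (intro of_real_less_1_in_hyp_slit_plane) simp
    \<comment> \<open>Euler's transformation absorbs the weight (1-y)^(a+b-c) into the
      hypergeometric factor of \<open>w2\<close>.\<close>
    have "hyp2F1 (1 - a) (1 - b) (2 - c) (of_real (- t)) =
      of_real (1 + t) powr (a + b - c) * hyp2F1 (a - c + 1) (b - c + 1) (2 - c) (of_real (- t))"
      using hyp2F1_euler[OF not_nonpos_Int_if_Re_pos[OF assms(3)] z, of "1 - a" "1 - b"]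
      by (simp add: algebra_simps)
    then show ?thesis
      using t by (simp add: h_def w2_def mult_ac add.commute)
  qed
  have int: "set_integrable lborel {0<..} (\<lambda>t. h (- t))"
    using S(1) eq by (subst set_integrable_cong[OF refl refl eq]) auto
  show "set_integrable lborel {..<0} h"
    by (rule set_integral_reflect_pos(1)[OF int])
  \<comment> \<open>The prefactor on the right-hand side cancels the one inside \<open>w6\<close>:
    the exponents add up to 0 and the base is nonzero since x differs from 1.\<close>
  have "complex_of_real \<bar>1 - x\<bar> powr (a + b - c + \<mu>) * of_real \<bar>1 - x\<bar> powr (c - \<mu> - a - b) = 1"
    using x unfolding powr_add[symmetric] by (auto simp: algebra_simps)
  then have w6: "complex_of_real \<bar>1 - x\<bar> powr (a + b - c + \<mu>) * w6 x a b (c - \<mu>) =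
      hyp2F1 (c - a - \<mu>) (c - b - \<mu>) (c - a - b - \<mu> + 1) (of_real (1 - x))"
    unfolding w6_def mult.assoc[symmetric] by (simp add: algebra_simps)
  have "set_lebesgue_integral lborel {..<0} h = set_lebesgue_integral lborel {0<..} (\<lambda>t. h (- t))"
    by (rule set_integral_reflect_pos(2)[OF int])
  also have "\<dots> = set_lebesgue_integral lborel {0<..} ?f"
    using eq by (intro set_lebesgue_integral_cong) auto
  also note S(2)
  finally show "set_lebesgue_integral lborel {..<0} h =
        Gamma (c - a - \<mu>) * Gamma (c - b - \<mu>) * Gamma (2 - c) *
          rGamma (c - a - b - \<mu> + 1) * rGamma (1 - \<mu>) *
          complex_of_real \<bar>1 - x\<bar> powr (a + b - c + \<mu>) * w6 x a b (c - \<mu>)"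
    unfolding mult.assoc w6[unfolded mult.assoc] by (simp add: mult_ac)
qed

text \<open>The Stieltjes transform with y = 1+t, s = 1-x, C = a+b-c+1, \<alpha> = c-b-\<mu>,
  \<beta> = c-a-\<mu> and \<delta> = c-\<mu>. The integrand already has the right form; Euler's
  transformation acts on the value instead and produces the power of 1-x next to
  \<open>w1\<close>.\<close>

lemma fractional_integral_w5:
  fixes a b c \<mu> :: complex and x :: real
  assumes "Re (c - a - \<mu>) > 0" "Re (c - b - \<mu>) > 0" "Re (a + b - c + 1) > 0"
    and \<delta>: "c - \<mu> \<notin> \<int>\<^sub>\<le>\<^sub>0" and x: "x \<in> {..<0} \<union> {0<..<1}"
  defines "h \<equiv> (\<lambda>y::real. complex_of_real (y - 1) powr (a + b - c) * w5 y a b c *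
                complex_of_real (y - x) powr (\<mu> - 1))"
  shows "set_integrable lborel {1<..} h"
    and "set_lebesgue_integral lborel {1<..} h =
        Gamma (c - a - \<mu>) * Gamma (c - b - \<mu>) * Gamma (a + b - c + 1) *
          rGamma (c - \<mu>) * rGamma (1 - \<mu>) *
          complex_of_real (1 - x) powr (a + b - c + \<mu>) * w1 x a b (c - \<mu>)"
proof -
  let ?f = "\<lambda>t. of_real t powr (a + b - c + 1 - 1) * hyp2F1 a b (a + b - c + 1) (of_real (- t)) *
      of_real (t + (1 - x)) powr (- (1 - \<mu>))"
  have "1 - x > 0"
    using x by auto
  have ident: "c - \<mu> - (c - a - \<mu>) = a" "c - \<mu> - (c - b - \<mu>) = b"
    "c - b - \<mu> + (c - a - \<mu>) + (a + b - c + 1) - (c - \<mu>) = 1 - \<mu>"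
    by (simp_all add: algebra_simps)
  note S = hyp2F1_Stieltjes_transform[OF assms(3,2,1) \<delta> \<open>1 - x > 0\<close>, unfolded ident]
  have h: "(\<lambda>t. h (1 + t)) = ?f"
    by (auto simp: h_def w5_def algebra_simps)
  have int: "set_integrable lborel {0<..} (\<lambda>t. h (1 + t))"
    unfolding h by (rule S(1))
  show "set_integrable lborel {1<..} h"
    by (rule set_integral_shift_pos(1)[OF int])
  have xs: "complex_of_real x \<in> hyp_slit_plane"
    using x by (intro of_real_less_1_in_hyp_slit_plane) auto
  have "complex_of_real (1 - x) powr (a + b - c + \<mu>) * of_real (1 - x) powr (c - \<mu> - a - b) = 1"
    using x unfolding powr_add[symmetric] by (auto simp: algebra_simps)
  moreover have "w1 x a b (c - \<mu>) = of_real (1 - x) powr (c - \<mu> - a - b) * hyp2F1 (c - a - \<mu>) (c - b - \<mu>) (c - \<mu>) (of_real x)"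
    using hyp2F1_euler[OF \<delta> xs, of a b] by (simp add: w1_def algebra_simps)
  ultimately have w1: "complex_of_real (1 - x) powr (a + b - c + \<mu>) * w1 x a b (c - \<mu>) =
      hyp2F1 (c - b - \<mu>) (c - a - \<mu>) (c - \<mu>) (of_real (1 - (1 - x)))"
    by (simp add: mult.assoc[symmetric] hyp2F1_commute[of "c - b - \<mu>"])
  have "set_lebesgue_integral lborel {1<..} h = set_lebesgue_integral lborel {0<..} ?f"
    unfolding set_integral_shift_pos(2)[OF int] h ..
  also note S(2)
  finally show "set_lebesgue_integral lborel {1<..} h =
        Gamma (c - a - \<mu>) * Gamma (c - b - \<mu>) * Gamma (a + b - c + 1) *
          rGamma (c - \<mu>) * rGamma (1 - \<mu>) *
          complex_of_real (1 - x) powr (a + b - c + \<mu>) * w1 x a b (c - \<mu>)"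
    unfolding mult.assoc w1[unfolded mult.assoc] by (simp add: mult_ac)
qed

text \<open>\<open>rGamma\<close> realises the convention that 1/\<Gamma> vanishes at the
  nonpositive integers. Integrability is asserted beside each value because the Lebesgue integral of
  a function that is not integrable defaults to 0.\<close>

theorem mainTheorem16:
  fixes a b c \<mu> :: complex
  shows
    "(Re (c - a - \<mu>) > 0 \<and> Re (c - b - \<mu>) > 0 \<and> Re (2 - c) > 0 \<and>
      2 - c \<notin> \<int>\<^sub>\<le>\<^sub>0 \<and> (c - \<mu>) - a - b + 1 \<notin> \<int>\<^sub>\<le>\<^sub>0 \<longrightarrow>
      (\<forall>x::real \<in> {0<..<1} \<union> {1<..}.
        set_integrable lborel {..<0}
          (\<lambda>y::real. complex_of_real (1 - y) powr (a + b - c) * w2 y a b c *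
                complex_of_real (x - y) powr (\<mu> - 1)) \<and>
        set_lebesgue_integral lborel {..<0}
          (\<lambda>y::real. complex_of_real (1 - y) powr (a + b - c) * w2 y a b c *
                complex_of_real (x - y) powr (\<mu> - 1)) =
        Gamma (c - a - \<mu>) * Gamma (c - b - \<mu>) * Gamma (2 - c) *
          rGamma (c - a - b - \<mu> + 1) * rGamma (1 - \<mu>) *
          complex_of_real \<bar>1 - x\<bar> powr (a + b - c + \<mu>) * w6 x a b (c - \<mu>)))
     \<and>
     (Re (c - a - \<mu>) > 0 \<and> Re (c - b - \<mu>) > 0 \<and> Re (a + b - c + 1) > 0 \<and>
      a + b - c + 1 \<notin> \<int>\<^sub>\<le>\<^sub>0 \<and> c - \<mu> \<notin> \<int>\<^sub>\<le>\<^sub>0 \<longrightarrow>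
      (\<forall>x::real \<in> {..<0} \<union> {0<..<1}.
        set_integrable lborel {1<..}
          (\<lambda>y::real. complex_of_real (y - 1) powr (a + b - c) * w5 y a b c *
                complex_of_real (y - x) powr (\<mu> - 1)) \<and>
        set_lebesgue_integral lborel {1<..}
          (\<lambda>y::real. complex_of_real (y - 1) powr (a + b - c) * w5 y a b c *
                complex_of_real (y - x) powr (\<mu> - 1)) =
        Gamma (c - a - \<mu>) * Gamma (c - b - \<mu>) * Gamma (a + b - c + 1) *
          rGamma (c - \<mu>) * rGamma (1 - \<mu>) *
          complex_of_real (1 - x) powr (a + b - c + \<mu>) * w1 x a b (c - \<mu>)))"
  by (intro conjI impI ballI; elim conjE; rule fractional_integral_w2 fractional_integral_w5; assumption)

end
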